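(* Let $\mathcal K$ be an equipment, let $J\colon A\nrightarrow B$ be a horizontal morphism, let $d\colon B\to M$ and $r\colon A\to M$ be vertical morphisms, and let $\varepsilon\colon J\Rightarrow 1_M$ be a cell with vertical source $r$ and vertical target $d$. For each vertical morphism $f\colon C\to A$ let $\mathrm{cart}_f\colon J(f,\mathrm{id})\Rightarrow J$ be the cartesian cell (with vertical source $f$ and vertical target $\mathrm{id}_B$) defining the restriction $J(f,\mathrm{id})\colon C\nrightarrow B$ of $J$ along $f$ and $\mathrm{id}_B$. Consider the following conditions: (a) the cell $\varepsilon$ defines $r$ as the pointwise right Kan extension of $d$ along $J$; (b) for all $f\colon C\to A$ the composite $\varepsilon\circ\mathrm{cart}_f$ defines $r\circ f$ as the pointwise right Kan extension of $d$ along $J(f,\mathrm{id})$; (c) for all $f\colon C\to A$ the composite $\varepsilon\circ\mathrm{cart}_f$ defines $r\circ f$ as the right Kan extension of $d$ along $J(f,\mathrm{id})$. Then (a) $\Leftrightarrow$ (b) $\Rightarrow$ (c). Moreover, if $\mathcal K$ has opcartesian tabulations, then (c) $\Rightarrow$ (a).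
   Context: **Double categories.** Double categories are weak (pseudo) double categories. A double category $\mathcal K$ has objects; vertical morphisms $f\colon A\to C$, forming a category; horizontal morphisms $J\colon A\nrightarrow B$; and square cells. A cell $\phi\colon J\Rightarrow K$, where $J\colon A\nrightarrow B$ and $K\colon C\nrightarrow D$, has a vertical source $f\colon A\to C$ and a vertical target $g\colon B\to D$. Cells compose vertically, written $\psi\circ\phi$ (first $\phi$, then $\psi$), strictly associatively and with identities $\mathrm{id}_J$. Horizontal composition is written in diagrammatic order: $J\colon A\nrightarrow B$ and $H\colon B\nrightarrow E$ compose to $J\odot H\colon A\nrightarrow E$, and cells $\phi\colon J\Rightarrow K$, $\chi\colon H\Rightarrow L$ such that the vertical target of $\phi$ equals the vertical source of $\chi$ compose to $\phi\odot\chi\colon J\odot H\Rightarrow K\odot L$; this is functorial (interchange law). There are horizontal units $1_A\colon A\nrightarrow A$ and unit cells $1_f\colon 1_A\Rightarrow 1_C$ with vertical source and target $f$. Horizontal composition is associative and unital up to coherent invertible cells with identity vertical source and target; these are suppressed from the notation. **Companions, conjoints, equipments.** A companion of $f\colon A\to C$ is a horizontal morphism $f_*\colon A\nrightarrow C$ with cells ${}_f\varepsilon\colon f_*\Rightarrow 1_C$ (vertical source $f$, vertical target $\mathrm{id}_C$) and ${}_f\eta\colon 1_A\Rightarrow f_*$ (vertical source $\mathrm{id}_A$, vertical target $f$) such that ${}_f\varepsilon\circ{}_f\eta=1_f$ and ${}_f\eta\odot{}_f\varepsilon=\mathrm{id}_{f_*}$. A conjoint of $f$ is a horizontal morphism $f^*\colon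 C\nrightarrow A$ with cells $\varepsilon_f\colon f^*\Rightarrow 1_C$ (vertical source $\mathrm{id}_C$, vertical target $f$) and $\eta_f\colon 1_A\Rightarrow f^*$ (vertical source $f$, vertical target $\mathrm{id}_A$) such that $\varepsilon_f\circ\eta_f=1_f$ and $\varepsilon_f\odot\eta_f=\mathrm{id}_{f^*}$. An equipment is a double category with a specified companion and a specified conjoint for each vertical morphism. **Cartesian and opcartesian cells.** A cell $\phi\colon J\Rightarrow K$ with vertical source $f\colon A\to C$ and vertical target $g\colon B\to D$ is cartesian if every cell $\psi\colon H\Rightarrow K$ with vertical source $f\circ h$ and vertical target $g\circ k$ factors as $\psi=\phi\circ\psi'$ for a unique cell $\psi'\colon H\Rightarrow J$ with vertical source $h$ and vertical target $k$; then $J$ is called the restriction $K(f,g)$ of $K$ along $f$ and $g$. In an equipment all restrictions exist, given by $K(f,g)=f_*\odot K\odot g^*$ with cartesian cell ${}_f\varepsilon\odot\mathrm{id}_K\odot\varepsilon_g$. Dually, $\phi$ is opcartesian if every cell $\chi\colon J\Rightarrow L$ with vertical source $h\circ f$ and vertical target $k\circ g$ factors as $\chi=\chi'\circ\phi$ for a unique cell $\chi'\colon K\Rightarrow L$ with vertical source $h$ and vertical target $k$. **Kan extensions.** Let $\varepsilon\colon J\Rightarrow 1_M$ be a cell with $J\colon A\nrightarrow B$, vertical source $r\colon A\to M$ and vertical target $d\colon B\to M$. It defines $r$ as the right Kan extension of $d$ along $J$ if every cell $\phi\colon J\Rightarrow 1_M$ with vertical target $d$ and any vertical source $s\colon A\to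 M$ factors as $\phi=\phi'\odot\varepsilon$ for a unique cell $\phi'\colon 1_A\Rightarrow 1_M$ with vertical source $s$ and vertical target $r$. It defines $r$ as the pointwise right Kan extension of $d$ along $J$ if for all $H\colon C\nrightarrow A$ and $s\colon C\to M$, every cell $\phi\colon H\odot J\Rightarrow 1_M$ with vertical source $s$ and vertical target $d$ factors as $\phi=\phi'\odot\varepsilon$ for a unique cell $\phi'\colon H\Rightarrow 1_M$ with vertical source $s$ and vertical target $r$. **Tabulations.** A tabulation of $J\colon A\nrightarrow B$ is an object $\langle J\rangle$ with a cell $\pi\colon 1_{\langle J\rangle}\Rightarrow J$, with vertical source $\pi_A\colon\langle J\rangle\to A$ and vertical target $\pi_B\colon\langle J\rangle\to B$, such that: (1-dimensional property) for every cell $\phi\colon 1_X\Rightarrow J$, with vertical source $\phi_A$ and vertical target $\phi_B$, there is a unique vertical morphism $\phi'\colon X\to\langle J\rangle$ with $\pi\circ 1_{\phi'}=\phi$ (in particular $\pi_A\circ\phi'=\phi_A$ and $\pi_B\circ\phi'=\phi_B$); (2-dimensional property) given cells $\phi\colon 1_X\Rightarrow J$ and $\psi\colon 1_Y\Rightarrow J$, factoring as $\phi'\colon X\to\langle J\rangle$ and $\psi'\colon Y\to\langle J\rangle$, a horizontal morphism $H\colon X\nrightarrow Y$ and cells $\xi_A\colon H\Rightarrow 1_A$ (vertical source $\phi_A$, vertical target $\psi_A$) and $\xi_B\colon H\Rightarrow 1_B$ (vertical source $\phi_B$, vertical target $\psi_B$) with $\xi_A\odot\psi=\phi\odot\xi_B$,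 there is a unique cell $\xi'\colon H\Rightarrow 1_{\langle J\rangle}$ with vertical source $\phi'$ and vertical target $\psi'$ such that $1_{\pi_A}\circ\xi'=\xi_A$ and $1_{\pi_B}\circ\xi'=\xi_B$. The tabulation is opcartesian if the cell $\pi$ is opcartesian. $\mathcal K$ has opcartesian tabulations if every horizontal morphism of $\mathcal K$ has an opcartesian tabulation. *)

theory Defs
  imports Main
begin

section \<open>Double categories\<close>

text \<open>
  Both kinds of vertical composition, \<open>\<cdot>\<close> of vertical morphisms and \<open>\<bullet>\<close> of cells, are written in
  applicative order (\<open>g \<cdot> f\<close> is first \<open>f\<close>, then \<open>g\<close>); horizontal composition, \<open>\<odot>\<close> of horizontal
  morphisms and \<open>\<star>\<close> of cells, is written in diagrammatic order.  The operations are only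
  meaningful on the carriers \<open>Obj\<close>, \<open>Ver\<close>, \<open>Hor\<close>, \<open>Cell\<close> and on composable arguments.
\<close>

record ('o, 'v, 'h, 'c) double_category_data =
  Obj :: "'o set"
  Ver :: "'v set"
  vdom :: "'v \<Rightarrow> 'o"
  vcod :: "'v \<Rightarrow> 'o"
  vid :: "'o \<Rightarrow> 'v"
  vcomp :: "'v \<Rightarrow> 'v \<Rightarrow> 'v"  (infixr \<open>\<cdot>\<index>\<close> 75)
  Hor :: "'h set"
  hsrc :: "'h \<Rightarrow> 'o"
  htgt :: "'h \<Rightarrow> 'o"
  hunit :: "'o \<Rightarrow> 'h"
  hcomp :: "'h \<Rightarrow> 'h \<Rightarrow> 'h"  (infixr \<open>\<odot>\<index>\<close> 80)
  Cell :: "'c set"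
  csrc :: "'c \<Rightarrow> 'h"
  ctgt :: "'c \<Rightarrow> 'h"
  cleft :: "'c \<Rightarrow> 'v"
  cright :: "'c \<Rightarrow> 'v"
  cid :: "'h \<Rightarrow> 'c"
  ccomp :: "'c \<Rightarrow> 'c \<Rightarrow> 'c"  (infixr \<open>\<bullet>\<index>\<close> 75)
  ucell :: "'v \<Rightarrow> 'c"
  chcomp :: "'c \<Rightarrow> 'c \<Rightarrow> 'c"  (infixr \<open>\<star>\<index>\<close> 80)
  assoc :: "'h \<Rightarrow> 'h \<Rightarrow> 'h \<Rightarrow> 'c"
  lunit :: "'h \<Rightarrow> 'c"
  runit :: "'h \<Rightarrow> 'c"

context
  fixes K :: "('o, 'v, 'h, 'c, 'z) double_category_data_scheme" (structure)
begin

definition ver :: "'o \<Rightarrow> 'o \<Rightarrow> 'v set" where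
  "ver A C = {f \<in> Ver K. vdom K f = A \<and> vcod K f = C}"

definition hor :: "'o \<Rightarrow> 'o \<Rightarrow> 'h set" where
  "hor A B = {J \<in> Hor K. hsrc K J = A \<and> htgt K J = B}"

text \<open>Cells \<open>J \<Rightarrow> L\<close> with vertical source \<open>f\<close> and vertical target \<open>g\<close>.\<close>

definition sq :: "'h \<Rightarrow> 'h \<Rightarrow> 'v \<Rightarrow> 'v \<Rightarrow> 'c set" where
  "sq J L f g =
    {\<phi> \<in> Cell K. csrc K \<phi> = J \<and> ctgt K \<phi> = L \<and> cleft K \<phi> = f \<and> cright K \<phi> = g}"

definition inverse_cells :: "'c \<Rightarrow> 'c \<Rightarrow> bool" where
  "inverse_cells \<alpha> \<beta> \<longleftrightarrow>
    \<alpha> \<in> Cell K \<and> \<beta> \<in> Cell K \<and> csrc K \<beta> = ctgt K \<alpha> \<and> ctgt K \<beta> = csrc K \<alpha> \<and>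
    \<beta> \<bullet> \<alpha> = cid K (csrc K \<alpha>) \<and> \<alpha> \<bullet> \<beta> = cid K (ctgt K \<alpha>)"

definition invertible :: "'c \<Rightarrow> bool" where
  "invertible \<alpha> \<longleftrightarrow> (\<exists>\<beta>. inverse_cells \<alpha> \<beta>)"

definition cinv :: "'c \<Rightarrow> 'c" where
  "cinv \<alpha> = (THE \<beta>. inverse_cells \<alpha> \<beta>)"

end

locale pseudo_double_category =
  fixes K :: "('o, 'v, 'h, 'c, 'z) double_category_data_scheme" (structure)
  assumes vdom_Obj: "f \<in> Ver K \<Longrightarrow> vdom K f \<in> Obj K"
    and vcod_Obj: "f \<in> Ver K \<Longrightarrow> vcod K f \<in> Obj K"
    and vid_ver: "A \<in> Obj K \<Longrightarrow> vid K A \<in> ver K A A"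
    and vcomp_ver: "\<lbrakk>f \<in> ver K A B; g \<in> ver K B C\<rbrakk> \<Longrightarrow> g \<cdot> f \<in> ver K A C"
    and vcomp_vid_right: "f \<in> ver K A B \<Longrightarrow> f \<cdot> vid K A = f"
    and vcomp_vid_left: "f \<in> ver K A B \<Longrightarrow> vid K B \<cdot> f = f"
    and vcomp_assoc:
      "\<lbrakk>f \<in> ver K A B; g \<in> ver K B C; h \<in> ver K C D\<rbrakk> \<Longrightarrow> (h \<cdot> g) \<cdot> f = h \<cdot> (g \<cdot> f)"
    and hsrc_Obj: "J \<in> Hor K \<Longrightarrow> hsrc K J \<in> Obj K"
    and htgt_Obj: "J \<in> Hor K \<Longrightarrow> htgt K J \<in> Obj K"
    and hunit_hor: "A \<in> Obj K \<Longrightarrow> hunit K A \<in> hor K A A"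
    and hcomp_hor: "\<lbrakk>J \<in> hor K A B; H \<in> hor K B E\<rbrakk> \<Longrightarrow> J \<odot> H \<in> hor K A E"
    and csrc_Hor: "\<phi> \<in> Cell K \<Longrightarrow> csrc K \<phi> \<in> Hor K"
    and ctgt_Hor: "\<phi> \<in> Cell K \<Longrightarrow> ctgt K \<phi> \<in> Hor K"
    and cleft_ver:
      "\<phi> \<in> Cell K \<Longrightarrow> cleft K \<phi> \<in> ver K (hsrc K (csrc K \<phi>)) (hsrc K (ctgt K \<phi>))"
    and cright_ver:
      "\<phi> \<in> Cell K \<Longrightarrow> cright K \<phi> \<in> ver K (htgt K (csrc K \<phi>)) (htgt K (ctgt K \<phi>))"
    and cid_sq: "J \<in> hor K A B \<Longrightarrow> cid K J \<in> sq K J J (vid K A) (vid K B)"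
    and ccomp_sq:
      "\<lbrakk>\<phi> \<in> sq K J L f g; \<psi> \<in> sq K L N h k\<rbrakk> \<Longrightarrow> \<psi> \<bullet> \<phi> \<in> sq K J N (h \<cdot> f) (k \<cdot> g)"
    and ccomp_cid_right: "\<phi> \<in> sq K J L f g \<Longrightarrow> \<phi> \<bullet> cid K J = \<phi>"
    and ccomp_cid_left: "\<phi> \<in> sq K J L f g \<Longrightarrow> cid K L \<bullet> \<phi> = \<phi>"
    and ccomp_assoc:
      "\<lbrakk>\<phi> \<in> sq K J L f g; \<psi> \<in> sq K L N h k; \<chi> \<in> sq K N P u v\<rbrakk>
        \<Longrightarrow> (\<chi> \<bullet> \<psi>) \<bullet> \<phi> = \<chi> \<bullet> (\<psi> \<bullet> \<phi>)"
    and ucell_sq: "f \<in> ver K A C \<Longrightarrow> ucell K f \<in> sq K (hunit K A) (hunit K C) f f"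
    and ucell_vid: "A \<in> Obj K \<Longrightarrow> ucell K (vid K A) = cid K (hunit K A)"
    and ucell_vcomp:
      "\<lbrakk>f \<in> ver K A B; g \<in> ver K B C\<rbrakk> \<Longrightarrow> ucell K (g \<cdot> f) = ucell K g \<bullet> ucell K f"
    and chcomp_sq:
      "\<lbrakk>\<phi> \<in> sq K J L f g; \<chi> \<in> sq K H N g k\<rbrakk> \<Longrightarrow> \<phi> \<star> \<chi> \<in> sq K (J \<odot> H) (L \<odot> N) f k"
    and chcomp_cid:
      "\<lbrakk>J \<in> hor K A B; H \<in> hor K B E\<rbrakk> \<Longrightarrow> cid K J \<star> cid K H = cid K (J \<odot> H)"
    and interchange:
      "\<lbrakk>\<phi> \<in> sq K J L f g; \<chi> \<in> sq K H N g k;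
        \<phi>' \<in> sq K L L' f' g'; \<chi>' \<in> sq K N N' g' k'\<rbrakk>
        \<Longrightarrow> (\<phi>' \<bullet> \<phi>) \<star> (\<chi>' \<bullet> \<chi>) = (\<phi>' \<star> \<chi>') \<bullet> (\<phi> \<star> \<chi>)"
    and assoc_sq:
      "\<lbrakk>J \<in> hor K A B; H \<in> hor K B C; L \<in> hor K C D\<rbrakk>
        \<Longrightarrow> assoc K J H L \<in> sq K ((J \<odot> H) \<odot> L) (J \<odot> (H \<odot> L)) (vid K A) (vid K D)"
    and assoc_invertible:
      "\<lbrakk>J \<in> hor K A B; H \<in> hor K B C; L \<in> hor K C D\<rbrakk> \<Longrightarrow> invertible K (assoc K J H L)"
    and assoc_natural:
      "\<lbrakk>\<phi> \<in> sq K J J' f g; \<chi> \<in> sq K H H' g h; \<psi> \<in> sq K L L' h k\<rbrakk>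
        \<Longrightarrow> assoc K J' H' L' \<bullet> ((\<phi> \<star> \<chi>) \<star> \<psi>) = (\<phi> \<star> (\<chi> \<star> \<psi>)) \<bullet> assoc K J H L"
    and lunit_sq:
      "J \<in> hor K A B \<Longrightarrow> lunit K J \<in> sq K (hunit K A \<odot> J) J (vid K A) (vid K B)"
    and lunit_invertible: "J \<in> Hor K \<Longrightarrow> invertible K (lunit K J)"
    and lunit_natural:
      "\<phi> \<in> sq K J L f g \<Longrightarrow> lunit K L \<bullet> (ucell K f \<star> \<phi>) = \<phi> \<bullet> lunit K J"
    and runit_sq:
      "J \<in> hor K A B \<Longrightarrow> runit K J \<in> sq K (J \<odot> hunit K B) J (vid K A) (vid K B)"
    and runit_invertible: "J \<in> Hor K \<Longrightarrow> invertible K (runit K J)"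
    and runit_natural:
      "\<phi> \<in> sq K J L f g \<Longrightarrow> runit K L \<bullet> (\<phi> \<star> ucell K g) = \<phi> \<bullet> runit K J"
    and pentagon:
      "\<lbrakk>J \<in> hor K A B; H \<in> hor K B C; L \<in> hor K C D; N \<in> hor K D E\<rbrakk>
        \<Longrightarrow> assoc K J H (L \<odot> N) \<bullet> assoc K (J \<odot> H) L N =
            (cid K J \<star> assoc K H L N) \<bullet> assoc K J (H \<odot> L) N \<bullet> (assoc K J H L \<star> cid K N)"
    and triangle:
      "\<lbrakk>J \<in> hor K A B; H \<in> hor K B C\<rbrakk>
        \<Longrightarrow> (cid K J \<star> lunit K H) \<bullet> assoc K J (hunit K B) H = runit K J \<star> cid K H"


section \<open>Universal properties in a double category\<close>

text \<open>
  Equations between cells that hold on the nose only after suppressing unit coherences are stated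
  below with the unitors \<open>lunit\<close> and \<open>runit\<close> inserted.
\<close>

context
  fixes K :: "('o, 'v, 'h, 'c, 'z) double_category_data_scheme" (structure)
begin

text \<open>\<open>F\<close> is a companion of \<open>f\<close>, with \<open>e : F \<Rightarrow> 1\<close> and \<open>n : 1 \<Rightarrow> F\<close>.\<close>

definition companion :: "'v \<Rightarrow> 'h \<Rightarrow> 'c \<Rightarrow> 'c \<Rightarrow> bool" where
  "companion f F e n \<longleftrightarrow>
    f \<in> Ver K \<and> F \<in> hor K (vdom K f) (vcod K f) \<and>
    e \<in> sq K F (hunit K (vcod K f)) f (vid K (vcod K f)) \<and>
    n \<in> sq K (hunit K (vdom K f)) F (vid K (vdom K f)) f \<and>
    e \<bullet> n = ucell K f \<and>
    runit K F \<bullet> (n \<star> e) \<bullet> cinv K (lunit K F) = cid K F"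

definition conjoint :: "'v \<Rightarrow> 'h \<Rightarrow> 'c \<Rightarrow> 'c \<Rightarrow> bool" where
  "conjoint f F e n \<longleftrightarrow>
    f \<in> Ver K \<and> F \<in> hor K (vcod K f) (vdom K f) \<and>
    e \<in> sq K F (hunit K (vcod K f)) (vid K (vcod K f)) f \<and>
    n \<in> sq K (hunit K (vdom K f)) F f (vid K (vdom K f)) \<and>
    e \<bullet> n = ucell K f \<and>
    lunit K F \<bullet> (e \<star> n) \<bullet> cinv K (runit K F) = cid K F"

definition cartesian :: "'c \<Rightarrow> bool" where
  "cartesian \<phi> \<longleftrightarrow>
    \<phi> \<in> Cell K \<and>
    (\<forall>X Y H h k \<psi>.
      h \<in> ver K X (vdom K (cleft K \<phi>)) \<and> k \<in> ver K Y (vdom K (cright K \<phi>)) \<and>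
      H \<in> hor K X Y \<and> \<psi> \<in> sq K H (ctgt K \<phi>) (cleft K \<phi> \<cdot> h) (cright K \<phi> \<cdot> k) \<longrightarrow>
      (\<exists>!\<psi>'. \<psi>' \<in> sq K H (csrc K \<phi>) h k \<and> \<psi> = \<phi> \<bullet> \<psi>'))"

definition opcartesian :: "'c \<Rightarrow> bool" where
  "opcartesian \<phi> \<longleftrightarrow>
    \<phi> \<in> Cell K \<and>
    (\<forall>X Y L h k \<chi>.
      h \<in> ver K (vcod K (cleft K \<phi>)) X \<and> k \<in> ver K (vcod K (cright K \<phi>)) Y \<and>
      L \<in> hor K X Y \<and> \<chi> \<in> sq K (csrc K \<phi>) L (h \<cdot> cleft K \<phi>) (k \<cdot> cright K \<phi>) \<longrightarrow>
      (\<exists>!\<chi>'. \<chi>' \<in> sq K (ctgt K \<phi>) L h k \<and> \<chi> = \<chi>' \<bullet> \<phi>))"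

text \<open>\<open>\<epsilon>\<close> defines \<open>r\<close> as the (pointwise) right Kan extension of \<open>d\<close> along \<open>J\<close>.\<close>

definition right_kan :: "'c \<Rightarrow> 'v \<Rightarrow> 'v \<Rightarrow> 'h \<Rightarrow> bool" where
  "right_kan \<epsilon> r d J \<longleftrightarrow>
    \<epsilon> \<in> sq K J (hunit K (vcod K d)) r d \<and>
    (\<forall>s \<phi>. s \<in> ver K (hsrc K J) (vcod K d) \<and> \<phi> \<in> sq K J (hunit K (vcod K d)) s d \<longrightarrow>
      (\<exists>!\<phi>'. \<phi>' \<in> sq K (hunit K (hsrc K J)) (hunit K (vcod K d)) s r \<and>
        \<phi> = lunit K (hunit K (vcod K d)) \<bullet> (\<phi>' \<star> \<epsilon>) \<bullet> cinv K (lunit K J)))"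

definition pointwise_right_kan :: "'c \<Rightarrow> 'v \<Rightarrow> 'v \<Rightarrow> 'h \<Rightarrow> bool" where
  "pointwise_right_kan \<epsilon> r d J \<longleftrightarrow>
    \<epsilon> \<in> sq K J (hunit K (vcod K d)) r d \<and>
    (\<forall>C H s \<phi>. H \<in> hor K C (hsrc K J) \<and> s \<in> ver K C (vcod K d) \<and>
      \<phi> \<in> sq K (H \<odot> J) (hunit K (vcod K d)) s d \<longrightarrow>
      (\<exists>!\<phi>'. \<phi>' \<in> sq K H (hunit K (vcod K d)) s r \<and>
        \<phi> = lunit K (hunit K (vcod K d)) \<bullet> (\<phi>' \<star> \<epsilon>)))"

definition tabulation :: "'h \<Rightarrow> 'o \<Rightarrow> 'c \<Rightarrow> bool" where
  "tabulation J T \<pi> \<longleftrightarrow>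
    J \<in> Hor K \<and> T \<in> Obj K \<and> \<pi> \<in> sq K (hunit K T) J (cleft K \<pi>) (cright K \<pi>) \<and>
    (\<forall>X \<phi>\<^sub>A \<phi>\<^sub>B \<phi>. X \<in> Obj K \<and> \<phi> \<in> sq K (hunit K X) J \<phi>\<^sub>A \<phi>\<^sub>B \<longrightarrow>
      (\<exists>!\<phi>'. \<phi>' \<in> ver K X T \<and> \<pi> \<bullet> ucell K \<phi>' = \<phi>)) \<and>
    (\<forall>X Y \<phi>\<^sub>A \<phi>\<^sub>B \<phi> \<phi>' \<psi>\<^sub>A \<psi>\<^sub>B \<psi> \<psi>' H \<xi>\<^sub>A \<xi>\<^sub>B.
      X \<in> Obj K \<and> \<phi> \<in> sq K (hunit K X) J \<phi>\<^sub>A \<phi>\<^sub>B \<and> \<phi>' \<in> ver K X T \<and> \<pi> \<bullet> ucell K \<phi>' = \<phi> \<and>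
      Y \<in> Obj K \<and> \<psi> \<in> sq K (hunit K Y) J \<psi>\<^sub>A \<psi>\<^sub>B \<and> \<psi>' \<in> ver K Y T \<and> \<pi> \<bullet> ucell K \<psi>' = \<psi> \<and>
      H \<in> hor K X Y \<and>
      \<xi>\<^sub>A \<in> sq K H (hunit K (hsrc K J)) \<phi>\<^sub>A \<psi>\<^sub>A \<and>
      \<xi>\<^sub>B \<in> sq K H (hunit K (htgt K J)) \<phi>\<^sub>B \<psi>\<^sub>B \<and>
      lunit K J \<bullet> (\<xi>\<^sub>A \<star> \<psi>) \<bullet> cinv K (runit K H) =
        runit K J \<bullet> (\<phi> \<star> \<xi>\<^sub>B) \<bullet> cinv K (lunit K H) \<longrightarrow>
      (\<exists>!\<xi>'. \<xi>' \<in> sq K H (hunit K T) \<phi>' \<psi>' \<and>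
        ucell K (cleft K \<pi>) \<bullet> \<xi>' = \<xi>\<^sub>A \<and> ucell K (cright K \<pi>) \<bullet> \<xi>' = \<xi>\<^sub>B))"

definition has_opcartesian_tabulations :: bool where
  "has_opcartesian_tabulations \<longleftrightarrow>
    (\<forall>J \<in> Hor K. \<exists>T \<pi>. tabulation J T \<pi> \<and> opcartesian \<pi>)"

end


section \<open>Equipments\<close>

record ('o, 'v, 'h, 'c) equipment_data = "('o, 'v, 'h, 'c) double_category_data" +
  comp_hor :: "'v \<Rightarrow> 'h"
  comp_counit :: "'v \<Rightarrow> 'c"
  comp_unit :: "'v \<Rightarrow> 'c"
  conj_hor :: "'v \<Rightarrow> 'h"
  conj_counit :: "'v \<Rightarrow> 'c"
  conj_unit :: "'v \<Rightarrow> 'c"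

locale equipment = pseudo_double_category K
  for K :: "('o, 'v, 'h, 'c, 'z) equipment_data_scheme" (structure) +
  assumes companion_comp:
      "f \<in> Ver K \<Longrightarrow> companion K f (comp_hor K f) (comp_counit K f) (comp_unit K f)"
    and conjoint_conj:
      "f \<in> Ver K \<Longrightarrow> conjoint K f (conj_hor K f) (conj_counit K f) (conj_unit K f)"

end

theory Submission
  imports Defs
begin

text \<open>
  (a) \<open>\<Rightarrow>\<close> (b): let \<open>F\<close> be the companion of \<open>f\<close> and \<open>R = J(f, id)\<close>.  Since \<open>R\<close> is a retract of \<open>F \<odot> J\<close>, a
  cell \<open>G \<odot> R \<Rightarrow> 1\<close> extends to \<open>(G \<odot> F) \<odot> J\<close>; factor it through \<open>\<epsilon>\<close> and precompose the factor with the
  companion unit \<open>G \<Rightarrow> G \<odot> F\<close>.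

  (b) \<open>\<Rightarrow>\<close> (a): for \<open>f = id\<close> the cartesian cell is invertible.

  (b) \<open>\<Rightarrow>\<close> (c): factor cells whose source is \<open>1 \<odot> R\<close>.

  (c) \<open>\<Rightarrow>\<close> (a): let \<open>\<pi> : 1 \<Rightarrow> H\<close> be an opcartesian tabulation with legs \<open>p\<close> and \<open>f\<close>, and \<open>P\<close> the conjoint
  of \<open>p\<close>.  Then \<open>H\<close> is a retract of \<open>P \<odot> F\<close>, from which \<open>\<pi> \<star> cart f : 1 \<odot> R \<Rightarrow> H \<odot> J\<close> is epic for cells
  with a fixed boundary.  Hence a cell on \<open>H \<odot> J\<close> is determined by its restriction to \<open>R\<close>; this factors
  through \<open>\<epsilon> \<bullet> cart f\<close> by (c), and the factor extends along \<open>\<pi>\<close> to \<open>H\<close>.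
\<close>

section \<open>Carriers and boundaries of composites\<close>

lemma in_sq_iff:
  "\<phi> \<in> sq K J L f g \<longleftrightarrow>
    \<phi> \<in> Cell K \<and> csrc K \<phi> = J \<and> ctgt K \<phi> = L \<and> cleft K \<phi> = f \<and> cright K \<phi> = g"
  by (simp add: sq_def)

lemma in_hor_iff: "J \<in> hor K A B \<longleftrightarrow> J \<in> Hor K \<and> hsrc K J = A \<and> htgt K J = B"
  by (simp add: hor_def)

lemma in_ver_iff: "f \<in> ver K A B \<longleftrightarrow> f \<in> Ver K \<and> vdom K f = A \<and> vcod K f = B"
  by (simp add: ver_def)

lemmas in_carrier_iff = in_sq_iff in_hor_iff in_ver_iff

context pseudo_double_category
begin

declare vdom_Obj [simp] vcod_Obj [simp] hsrc_Obj [simp] htgt_Obj [simp] csrc_Hor [simp] ctgt_Hor [simp]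
  ucell_vid [simp]

lemma in_sq: "\<phi> \<in> Cell K \<Longrightarrow> \<phi> \<in> sq K (csrc K \<phi>) (ctgt K \<phi>) (cleft K \<phi>) (cright K \<phi>)"
  by (simp add: in_sq_iff)

lemma in_hor: "J \<in> Hor K \<Longrightarrow> J \<in> hor K (hsrc K J) (htgt K J)"
  by (simp add: in_hor_iff)

lemma in_ver: "f \<in> Ver K \<Longrightarrow> f \<in> ver K (vdom K f) (vcod K f)"
  by (simp add: in_ver_iff)

lemma vid_simps [simp]:
  assumes "A \<in> Obj K"
  shows "vid K A \<in> Ver K" "vdom K (vid K A) = A" "vcod K (vid K A) = A"
  using vid_ver[OF assms] by (auto simp: in_ver_iff)

lemma vcomp_simps [simp]:
  assumes "f \<in> Ver K" "g \<in> Ver K" "vdom K g = vcod K f"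
  shows "g \<cdot> f \<in> Ver K" "vdom K (g \<cdot> f) = vdom K f" "vcod K (g \<cdot> f) = vcod K g"
  using vcomp_ver[of f "vdom K f" "vcod K f" g "vcod K g"] assms by (auto simp: in_ver_iff)

lemma vcomp_vid_simps [simp]:
  assumes "f \<in> Ver K"
  shows "vdom K f = A \<Longrightarrow> f \<cdot> vid K A = f" "vcod K f = B \<Longrightarrow> vid K B \<cdot> f = f"
  using vcomp_vid_right vcomp_vid_left in_ver[OF assms] by auto

lemma vcomp_assoc_simp [simp]:
  assumes "f \<in> Ver K" "g \<in> Ver K" "h \<in> Ver K" "vdom K g = vcod K f" "vdom K h = vcod K g"
  shows "(h \<cdot> g) \<cdot> f = h \<cdot> (g \<cdot> f)"
  using vcomp_assoc assms by (simp add: in_ver_iff)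

lemma hunit_simps [simp]:
  assumes "A \<in> Obj K"
  shows "hunit K A \<in> Hor K" "hsrc K (hunit K A) = A" "htgt K (hunit K A) = A"
  using hunit_hor[OF assms] by (auto simp: in_hor_iff)

lemma hcomp_simps [simp]:
  assumes "J \<in> Hor K" "H \<in> Hor K" "htgt K J = hsrc K H"
  shows "J \<odot> H \<in> Hor K" "hsrc K (J \<odot> H) = hsrc K J" "htgt K (J \<odot> H) = htgt K H"
  using hcomp_hor[of J "hsrc K J" "htgt K J" H "htgt K H"] assms by (auto simp: in_hor_iff)

lemma boundary_simps [simp]:
  assumes "\<phi> \<in> Cell K"
  shows "cleft K \<phi> \<in> Ver K" "cright K \<phi> \<in> Ver K"
    and "vdom K (cleft K \<phi>) = hsrc K (csrc K \<phi>)" "vcod K (cleft K \<phi>) = hsrc K (ctgt K \<phi>)"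
    and "vdom K (cright K \<phi>) = htgt K (csrc K \<phi>)" "vcod K (cright K \<phi>) = htgt K (ctgt K \<phi>)"
  using cleft_ver[OF assms] cright_ver[OF assms] by (auto simp: in_ver_iff)

lemma cid_simps [simp]:
  assumes "J \<in> Hor K"
  shows "cid K J \<in> Cell K" "csrc K (cid K J) = J" "ctgt K (cid K J) = J"
    and "cleft K (cid K J) = vid K (hsrc K J)" "cright K (cid K J) = vid K (htgt K J)"
  using cid_sq[OF in_hor[OF assms]] by (auto simp: in_sq_iff)

lemma ccomp_simps [simp]:
  assumes "\<phi> \<in> Cell K" "\<psi> \<in> Cell K" "csrc K \<psi> = ctgt K \<phi>"
  shows "\<psi> \<bullet> \<phi> \<in> Cell K" "csrc K (\<psi> \<bullet> \<phi>) = csrc K \<phi>" "ctgt K (\<psi> \<bullet> \<phi>) = ctgt K \<psi>"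
    and "cleft K (\<psi> \<bullet> \<phi>) = cleft K \<psi> \<cdot> cleft K \<phi>"
    and "cright K (\<psi> \<bullet> \<phi>) = cright K \<psi> \<cdot> cright K \<phi>"
  using ccomp_sq[of \<phi> _ _ _ _ \<psi>] assms
  by (auto simp: in_sq_iff)

lemma ccomp_cid_simps [simp]:
  assumes "\<phi> \<in> Cell K"
  shows "csrc K \<phi> = J \<Longrightarrow> \<phi> \<bullet> cid K J = \<phi>" "ctgt K \<phi> = L \<Longrightarrow> cid K L \<bullet> \<phi> = \<phi>"
  using ccomp_cid_right ccomp_cid_left in_sq[OF assms] by auto

lemma ccomp_assoc_simp [simp]:
  assumes "\<phi> \<in> Cell K" "\<psi> \<in> Cell K" "\<chi> \<in> Cell K" "csrc K \<psi> = ctgt K \<phi>" "csrc K \<chi> = ctgt K \<psi>"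
  shows "(\<chi> \<bullet> \<psi>) \<bullet> \<phi> = \<chi> \<bullet> (\<psi> \<bullet> \<phi>)"
  using ccomp_assoc assms by (simp add: in_sq_iff)

lemma ucell_simps [simp]:
  assumes "f \<in> Ver K"
  shows "ucell K f \<in> Cell K"
    and "csrc K (ucell K f) = hunit K (vdom K f)" "ctgt K (ucell K f) = hunit K (vcod K f)"
    and "cleft K (ucell K f) = f" "cright K (ucell K f) = f"
  using ucell_sq[OF in_ver[OF assms]] by (auto simp: in_sq_iff)

lemma ucell_vcomp_simp:
  assumes "f \<in> Ver K" "g \<in> Ver K" "vdom K g = vcod K f"
  shows "ucell K g \<bullet> ucell K f = ucell K (g \<cdot> f)"
  using ucell_vcomp[of f _ _ g] assms by (simp add: in_ver_iff)

lemma chcomp_simps [simp]: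
  assumes "\<phi> \<in> Cell K" "\<chi> \<in> Cell K" "cright K \<phi> = cleft K \<chi>"
  shows "\<phi> \<star> \<chi> \<in> Cell K"
    and "csrc K (\<phi> \<star> \<chi>) = csrc K \<phi> \<odot> csrc K \<chi>" "ctgt K (\<phi> \<star> \<chi>) = ctgt K \<phi> \<odot> ctgt K \<chi>"
    and "cleft K (\<phi> \<star> \<chi>) = cleft K \<phi>" "cright K (\<phi> \<star> \<chi>) = cright K \<chi>"
  using chcomp_sq[of \<phi> _ _ _ _ \<chi>] assms by (auto simp: in_sq_iff)

lemma chcomp_cid_simp [simp]:
  assumes "J \<in> Hor K" "H \<in> Hor K" "htgt K J = hsrc K H"
  shows "cid K J \<star> cid K H = cid K (J \<odot> H)"
  using chcomp_cid assms by (simp add: in_hor_iff)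

text \<open>Oriented from a vertical composite of rows to a horizontal composite of columns, the
  direction in which equations such as \<open>e \<bullet> n = ucell K f\<close> become applicable
  inside one column.\<close>

lemma interchange_simp:
  assumes "\<phi> \<in> Cell K" "\<chi> \<in> Cell K" "\<phi>' \<in> Cell K" "\<chi>' \<in> Cell K"
    and "csrc K \<phi>' = ctgt K \<phi>" "csrc K \<chi>' = ctgt K \<chi>"
    and "cright K \<phi> = cleft K \<chi>" "cright K \<phi>' = cleft K \<chi>'"
  shows "(\<phi>' \<star> \<chi>') \<bullet> (\<phi> \<star> \<chi>) = (\<phi>' \<bullet> \<phi>) \<star> (\<chi>' \<bullet> \<chi>)"
  using interchange assms by (simp add: in_sq_iff)

section \<open>Inverses of the coherence cells\<close>

text \<open>Since \<open>cinv\<close> is a definite description, uniqueness is required: for two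
  inverses \<gamma> and \<beta> of \<alpha>, \<open>\<gamma> = \<gamma> \<bullet> (\<alpha>
  \<bullet> \<beta>) = (\<gamma> \<bullet> \<alpha>) \<bullet> \<beta> = \<beta>\<close>.\<close>

lemma inverse_cells_cinv:
  assumes "invertible K \<alpha>"
  shows "inverse_cells K \<alpha> (cinv K \<alpha>)"
proof -
  obtain \<beta> where \<beta>: "inverse_cells K \<alpha> \<beta>"
    using assms by (auto simp: invertible_def)
  have "\<gamma> = \<beta>" if "inverse_cells K \<alpha> \<gamma>" for \<gamma>
  proof -
    have \<gamma>: "\<gamma> \<in> Cell K" "csrc K \<gamma> = ctgt K \<alpha>" "ctgt K \<gamma> = csrc K \<alpha>" "\<gamma> \<bullet> \<alpha> = cid K (csrc K \<alpha>)"
      and \<beta>': "\<alpha> \<in> Cell K" "\<beta> \<in> Cell K" "csrc K \<beta> = ctgt K \<alpha>" "ctgt K \<beta> = csrc K \<alpha>"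
        "\<alpha> \<bullet> \<beta> = cid K (ctgt K \<alpha>)"
      using that \<beta> by (auto simp: inverse_cells_def)
    have "\<gamma> = \<gamma> \<bullet> (\<alpha> \<bullet> \<beta>)"
      unfolding \<beta>'(5) using \<gamma>(1,2) by simp
    also have "\<dots> = (\<gamma> \<bullet> \<alpha>) \<bullet> \<beta>"
      using \<gamma>(1-3) \<beta>'(1-4) by simp
    also have "\<dots> = \<beta>"
      unfolding \<gamma>(4) using \<beta>'(2,4) by simp
    finally show ?thesis .
  qed
  then show ?thesis
    unfolding cinv_def using \<beta> by (metis theI)
qed

text \<open>\<open>inverse_cells\<close> does not mention vertical boundaries. As those of \<alpha>
  are identities, the inverse has the same boundaries as its composite with \<alpha>, which is
  \<open>cid K J\<close>.\<close>

lemma cinv_globular: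
  assumes "invertible K \<alpha>" and "\<alpha> \<in> sq K J L (vid K A) (vid K B)" and "J \<in> hor K A B" "L \<in> hor K A B"
  shows "cinv K \<alpha> \<in> sq K L J (vid K A) (vid K B)"
    and "cinv K \<alpha> \<bullet> \<alpha> = cid K J" "\<alpha> \<bullet> cinv K \<alpha> = cid K L"
proof -
  let ?\<beta> = "cinv K \<alpha>"
  have \<beta>: "?\<beta> \<in> Cell K" "csrc K ?\<beta> = L" "ctgt K ?\<beta> = J"
    and eqs: "?\<beta> \<bullet> \<alpha> = cid K J" "\<alpha> \<bullet> ?\<beta> = cid K L"
    using inverse_cells_cinv[OF assms(1)] assms(2) by (auto simp: inverse_cells_def in_sq_iff)
  have AB: "A \<in> Obj K" "B \<in> Obj K"
    using assms(3) by (auto simp: in_hor_iff)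
  have "cleft K ?\<beta> = cleft K (?\<beta> \<bullet> \<alpha>)" "cright K ?\<beta> = cright K (?\<beta> \<bullet> \<alpha>)"
    using \<beta> AB assms by (simp_all add: in_carrier_iff)
  then show "?\<beta> \<in> sq K L J (vid K A) (vid K B)"
    using \<beta> eqs AB assms by (simp add: in_carrier_iff)
  show "?\<beta> \<bullet> \<alpha> = cid K J" "\<alpha> \<bullet> ?\<beta> = cid K L"
    by fact+
qed

lemma assoc_simps [simp]:
  assumes "J \<in> Hor K" "H \<in> Hor K" "L \<in> Hor K" "htgt K J = hsrc K H" "htgt K H = hsrc K L"
  shows "assoc K J H L \<in> Cell K"
    and "csrc K (assoc K J H L) = (J \<odot> H) \<odot> L" "ctgt K (assoc K J H L) = J \<odot> (H \<odot> L)"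
    and "cleft K (assoc K J H L) = vid K (hsrc K J)" "cright K (assoc K J H L) = vid K (htgt K L)"
    and "cinv K (assoc K J H L) \<in> Cell K"
    and "csrc K (cinv K (assoc K J H L)) = J \<odot> (H \<odot> L)"
    and "ctgt K (cinv K (assoc K J H L)) = (J \<odot> H) \<odot> L"
    and "cleft K (cinv K (assoc K J H L)) = vid K (hsrc K J)"
    and "cright K (cinv K (assoc K J H L)) = vid K (htgt K L)"
    and "assoc K J H L \<bullet> cinv K (assoc K J H L) = cid K (J \<odot> (H \<odot> L))"
    and "cinv K (assoc K J H L) \<bullet> assoc K J H L = cid K ((J \<odot> H) \<odot> L)"
proof -
  have hors: "J \<in> hor K (hsrc K J) (hsrc K H)" "H \<in> hor K (hsrc K H) (hsrc K L)"
    "L \<in> hor K (hsrc K L) (htgt K L)"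
    using assms by (auto simp: in_hor_iff)
  note a = assoc_sq[OF hors] and i = assoc_invertible[OF hors]
  have "(J \<odot> H) \<odot> L \<in> hor K (hsrc K J) (htgt K L)" "J \<odot> (H \<odot> L) \<in> hor K (hsrc K J) (htgt K L)"
    using assms by (auto simp: in_hor_iff)
  from a cinv_globular[OF i a this] show
    "assoc K J H L \<in> Cell K"
    "csrc K (assoc K J H L) = (J \<odot> H) \<odot> L" "ctgt K (assoc K J H L) = J \<odot> (H \<odot> L)"
    "cleft K (assoc K J H L) = vid K (hsrc K J)" "cright K (assoc K J H L) = vid K (htgt K L)"
    "cinv K (assoc K J H L) \<in> Cell K"
    "csrc K (cinv K (assoc K J H L)) = J \<odot> (H \<odot> L)"
    "ctgt K (cinv K (assoc K J H L)) = (J \<odot> H) \<odot> L"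
    "cleft K (cinv K (assoc K J H L)) = vid K (hsrc K J)"
    "cright K (cinv K (assoc K J H L)) = vid K (htgt K L)"
    "assoc K J H L \<bullet> cinv K (assoc K J H L) = cid K (J \<odot> (H \<odot> L))"
    "cinv K (assoc K J H L) \<bullet> assoc K J H L = cid K ((J \<odot> H) \<odot> L)"
    by (auto simp: in_sq_iff)
qed

lemma lunit_simps [simp]:
  assumes "J \<in> Hor K"
  shows "lunit K J \<in> Cell K"
    and "csrc K (lunit K J) = hunit K (hsrc K J) \<odot> J" "ctgt K (lunit K J) = J"
    and "cleft K (lunit K J) = vid K (hsrc K J)" "cright K (lunit K J) = vid K (htgt K J)"
    and "cinv K (lunit K J) \<in> Cell K"
    and "csrc K (cinv K (lunit K J)) = J" "ctgt K (cinv K (lunit K J)) = hunit K (hsrc K J) \<odot> J"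
    and "cleft K (cinv K (lunit K J)) = vid K (hsrc K J)"
    and "cright K (cinv K (lunit K J)) = vid K (htgt K J)"
    and "lunit K J \<bullet> cinv K (lunit K J) = cid K J"
    and "cinv K (lunit K J) \<bullet> lunit K J = cid K (hunit K (hsrc K J) \<odot> J)"
  using lunit_sq[OF in_hor[OF assms]] assms
    cinv_globular[OF lunit_invertible[OF assms] lunit_sq[OF in_hor[OF assms]]]
  by (auto simp: in_sq_iff in_hor_iff)

lemma runit_simps [simp]:
  assumes "J \<in> Hor K"
  shows "runit K J \<in> Cell K"
    and "csrc K (runit K J) = J \<odot> hunit K (htgt K J)" "ctgt K (runit K J) = J"
    and "cleft K (runit K J) = vid K (hsrc K J)" "cright K (runit K J) = vid K (htgt K J)"
    and "cinv K (runit K J) \<in> Cell K"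
    and "csrc K (cinv K (runit K J)) = J" "ctgt K (cinv K (runit K J)) = J \<odot> hunit K (htgt K J)"
    and "cleft K (cinv K (runit K J)) = vid K (hsrc K J)"
    and "cright K (cinv K (runit K J)) = vid K (htgt K J)"
    and "runit K J \<bullet> cinv K (runit K J) = cid K J"
    and "cinv K (runit K J) \<bullet> runit K J = cid K (J \<odot> hunit K (htgt K J))"
  using runit_sq[OF in_hor[OF assms]] assms
    cinv_globular[OF runit_invertible[OF assms] runit_sq[OF in_hor[OF assms]]]
  by (auto simp: in_sq_iff in_hor_iff)

section \<open>Naturality, interchange and unit coherence\<close>

lemma assoc_natural':
  assumes "\<phi> \<in> Cell K" "\<chi> \<in> Cell K" "\<psi> \<in> Cell K" "cright K \<phi> = cleft K \<chi>" "cright K \<chi> = cleft K \<psi>"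
  shows "assoc K (ctgt K \<phi>) (ctgt K \<chi>) (ctgt K \<psi>) \<bullet> ((\<phi> \<star> \<chi>) \<star> \<psi>) =
    (\<phi> \<star> (\<chi> \<star> \<psi>)) \<bullet> assoc K (csrc K \<phi>) (csrc K \<chi>) (csrc K \<psi>)"
  using assoc_natural assms by (simp add: in_sq_iff)

lemma lunit_natural':
  assumes "\<phi> \<in> Cell K"
  shows "lunit K (ctgt K \<phi>) \<bullet> (ucell K (cleft K \<phi>) \<star> \<phi>) = \<phi> \<bullet> lunit K (csrc K \<phi>)"
  using lunit_natural[OF in_sq[OF assms]] .

lemma runit_natural':
  assumes "\<phi> \<in> Cell K"
  shows "runit K (ctgt K \<phi>) \<bullet> (\<phi> \<star> ucell K (cright K \<phi>)) = \<phi> \<bullet> runit K (csrc K \<phi>)"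
  using runit_natural[OF in_sq[OF assms]] .

text \<open>Naturality of \<open>lunit\<close> conjugated by inverses: insert a unitor and its
  inverse at the source of \<phi>, apply naturality, and cancel the pair that appears at the
  target.\<close>

lemma cinv_lunit_natural:
  assumes "\<phi> \<in> Cell K"
  shows "cinv K (lunit K (ctgt K \<phi>)) \<bullet> \<phi> =
    (ucell K (cleft K \<phi>) \<star> \<phi>) \<bullet> cinv K (lunit K (csrc K \<phi>))"
proof -
  have "cinv K (lunit K (ctgt K \<phi>)) \<bullet> \<phi> =
    cinv K (lunit K (ctgt K \<phi>)) \<bullet> (\<phi> \<bullet> lunit K (csrc K \<phi>)) \<bullet> cinv K (lunit K (csrc K \<phi>))"
    using assms by simp
  also have "\<dots> = cinv K (lunit K (ctgt K \<phi>)) \<bullet>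
    (lunit K (ctgt K \<phi>) \<bullet> (ucell K (cleft K \<phi>) \<star> \<phi>)) \<bullet> cinv K (lunit K (csrc K \<phi>))"
    using assms by (simp only: lunit_natural')
  also have "\<dots> = (cinv K (lunit K (ctgt K \<phi>)) \<bullet> lunit K (ctgt K \<phi>)) \<bullet>
    (ucell K (cleft K \<phi>) \<star> \<phi>) \<bullet> cinv K (lunit K (csrc K \<phi>))"
    using assms by (simp del: lunit_simps(11,12))
  also have "\<dots> = (ucell K (cleft K \<phi>) \<star> \<phi>) \<bullet> cinv K (lunit K (csrc K \<phi>))"
    using assms by (simp del: ccomp_assoc_simp)
  finally show ?thesis .
qed

lemma triangle':
  assumes "J \<in> Hor K" "H \<in> Hor K" "htgt K J = hsrc K H"
  shows "(cid K J \<star> lunit K H) \<bullet> assoc K J (hunit K (hsrc K H)) H = runit K J \<star> cid K H"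
  using triangle[of J "hsrc K J" "hsrc K H" H] assms by (simp add: in_hor_iff)


text \<open>Composites are kept nested to the right, so two adjacent rows usually occur with a
  further cell \<theta> applied before them; this is the interchange law in that position.\<close>

lemma interchange_ccomp:
  assumes "\<phi> \<in> Cell K" "\<chi> \<in> Cell K" "\<phi>' \<in> Cell K" "\<chi>' \<in> Cell K"
    and "csrc K \<phi>' = ctgt K \<phi>" "csrc K \<chi>' = ctgt K \<chi>"
    and "cright K \<phi> = cleft K \<chi>" "cright K \<phi>' = cleft K \<chi>'"
    and "\<theta> \<in> Cell K" "ctgt K \<theta> = csrc K \<phi> \<odot> csrc K \<chi>"
  shows "(\<phi>' \<star> \<chi>') \<bullet> (\<phi> \<star> \<chi>) \<bullet> \<theta> = ((\<phi>' \<bullet> \<phi>) \<star> (\<chi>' \<bullet> \<chi>)) \<bullet> \<theta>"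
  using interchange_simp[OF assms(1-8), symmetric] assms by simp

lemma ccomp_cancel_right_inverse:
  assumes "\<phi> \<in> Cell K" "\<psi> \<in> Cell K" "\<alpha> \<in> Cell K" "\<beta> \<in> Cell K"
    and "csrc K \<phi> = ctgt K \<alpha>" "csrc K \<psi> = ctgt K \<alpha>" "csrc K \<alpha> = ctgt K \<beta>"
    and "\<alpha> \<bullet> \<beta> = cid K (ctgt K \<alpha>)" "\<phi> \<bullet> \<alpha> = \<psi> \<bullet> \<alpha>"
  shows "\<phi> = \<psi>"
proof -
  have "\<phi> \<bullet> (\<alpha> \<bullet> \<beta>) = \<psi> \<bullet> (\<alpha> \<bullet> \<beta>)"
    using assms(1-7) arg_cong[OF assms(9), of "\<lambda>\<theta>. \<theta> \<bullet> \<beta>"] by simp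
  then show ?thesis
    unfolding assms(8) using assms(1-6) by simp
qed

text \<open>By naturality of \<open>lunit\<close>, the unit composite determines
  \<open>\<phi> \<bullet> lunit K (csrc K \<phi>)\<close>, and the unitor can be cancelled because
  it has a right inverse.\<close>

lemma hunit_chcomp_faithful:
  assumes "\<phi> \<in> Cell K" "\<psi> \<in> Cell K" "csrc K \<phi> = csrc K \<psi>" "ctgt K \<phi> = ctgt K \<psi>"
    and "cleft K \<phi> = cleft K \<psi>"
    and "ucell K (cleft K \<phi>) \<star> \<phi> = ucell K (cleft K \<psi>) \<star> \<psi>"
  shows "\<phi> = \<psi>"
proof (rule ccomp_cancel_right_inverse)
  show "\<phi> \<bullet> lunit K (csrc K \<psi>) = \<psi> \<bullet> lunit K (csrc K \<psi>)"
    using lunit_natural'[OF assms(1)] lunit_natural'[OF assms(2)] assms(3-6) by simp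
  show "lunit K (csrc K \<psi>) \<bullet> cinv K (lunit K (csrc K \<psi>)) = cid K (ctgt K (lunit K (csrc K \<psi>)))"
    using assms by simp
qed (use assms in simp_all)

text \<open>Kelly's argument: tensored with a unit on the left, the equation follows from the pentagon.\<close>

lemma lunit_hcomp:
  assumes [simp]: "F \<in> Hor K" "J \<in> Hor K" "htgt K F = hsrc K J"
  shows "lunit K (F \<odot> J) \<bullet> assoc K (hunit K (hsrc K F)) F J = lunit K F \<star> cid K J"
proof -
  let ?I = "hunit K (hsrc K F)"
  \<comment> \<open>\<open>?P\<close> is the composite of associators that both sides of the
    tensored equation share after the pentagon is applied; \<open>?Q\<close> is its right inverse,
    so it can be cancelled at the end.\<close>
  let ?P = "assoc K ?I (?I \<odot> F) J \<bullet> (assoc K ?I ?I F \<star> cid K J)"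
  let ?Q = "(cinv K (assoc K ?I ?I F) \<star> cid K J) \<bullet> cinv K (assoc K ?I (?I \<odot> F) J)"
  have pent: "assoc K ?I ?I (F \<odot> J) \<bullet> assoc K (?I \<odot> ?I) F J =
    (cid K ?I \<star> assoc K ?I F J) \<bullet> ?P"
    by (rule pentagon) (auto simp: in_hor_iff)
  have "(cid K ?I \<star> (lunit K (F \<odot> J) \<bullet> assoc K ?I F J)) \<bullet> ?P =
    (cid K ?I \<star> lunit K (F \<odot> J)) \<bullet> (cid K ?I \<star> assoc K ?I F J) \<bullet> ?P"
    by (simp add: interchange_ccomp)
  also have "\<dots> = ((cid K ?I \<star> lunit K (F \<odot> J)) \<bullet> assoc K ?I ?I (F \<odot> J)) \<bullet>
      assoc K (?I \<odot> ?I) F J"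
    unfolding pent[symmetric] by simp
  \<comment> \<open>The triangle for \<open>?I\<close> and \<open>F \<odot> J\<close> trades the
    left unitor for \<open>runit K ?I\<close>. Naturality of the associator moves this across, and
    the triangle for \<open>?I\<close> and \<open>F\<close> turns it into
    \<open>lunit K F\<close>.\<close>
  also have "\<dots> = (runit K ?I \<star> (cid K F \<star> cid K J)) \<bullet> assoc K (?I \<odot> ?I) F J"
    using triangle'[of ?I "F \<odot> J"] by (simp del: ccomp_assoc_simp)
  also have "\<dots> = assoc K ?I F J \<bullet> ((runit K ?I \<star> cid K F) \<star> cid K J)"
    using assoc_natural'[of "runit K ?I" "cid K F" "cid K J"] by (simp del: chcomp_cid_simp)
  also have "runit K ?I \<star> cid K F = (cid K ?I \<star> lunit K F) \<bullet> assoc K ?I ?I F"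
    using triangle'[of ?I F] by simp
  also have "assoc K ?I F J \<bullet> (\<dots> \<star> cid K J) =
    assoc K ?I F J \<bullet> ((cid K ?I \<star> lunit K F) \<star> cid K J) \<bullet> (assoc K ?I ?I F \<star> cid K J)"
    by (simp add: interchange_simp)
  also have "\<dots> = (assoc K ?I F J \<bullet> ((cid K ?I \<star> lunit K F) \<star> cid K J)) \<bullet>
      (assoc K ?I ?I F \<star> cid K J)"
    by simp
  also have "\<dots> = (cid K ?I \<star> (lunit K F \<star> cid K J)) \<bullet> ?P"
    using assoc_natural'[of "cid K ?I" "lunit K F" "cid K J"] by simp
  finally have eq: "(cid K ?I \<star> (lunit K (F \<odot> J) \<bullet> assoc K ?I F J)) \<bullet> ?P =
    (cid K ?I \<star> (lunit K F \<star> cid K J)) \<bullet> ?P" .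
  have inv: "?P \<bullet> ?Q = cid K (ctgt K ?P)"
  proof -
    have "?P \<bullet> ?Q = assoc K ?I (?I \<odot> F) J \<bullet> (((assoc K ?I ?I F \<star> cid K J) \<bullet>
      (cinv K (assoc K ?I ?I F) \<star> cid K J)) \<bullet> cinv K (assoc K ?I (?I \<odot> F) J))"
      by simp
    also have "\<dots> = cid K (ctgt K ?P)"
      by (simp add: interchange_simp del: ccomp_assoc_simp)
    finally show ?thesis .
  qed
  have "cid K ?I \<star> (lunit K (F \<odot> J) \<bullet> assoc K ?I F J) = cid K ?I \<star> (lunit K F \<star> cid K J)"
    by (rule ccomp_cancel_right_inverse[OF _ _ _ _ _ _ _ inv eq]) simp_all
  then show ?thesis
    by - (rule hunit_chcomp_faithful, simp_all)
qed

section \<open>Pointwise and ordinary Kan extensions\<close>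

text \<open>Test the pointwise property on the horizontal unit at the source of \<open>J\<close>:
  composing with \<open>lunit K J\<close> identifies cells out of \<open>J\<close> with cells out of
  \<open>hunit K (hsrc K J) \<odot> J\<close>.\<close>

lemma pointwise_imp_right_kan:
  assumes "pointwise_right_kan K \<epsilon> r d J" "d \<in> Ver K" "J \<in> Hor K"
  shows "right_kan K \<epsilon> r d J"
  unfolding right_kan_def
proof (intro conjI allI impI)
  let ?M = "vcod K d" and ?A = "hsrc K J"
  show \<epsilon>: "\<epsilon> \<in> sq K J (hunit K ?M) r d"
    using assms(1) by (simp add: pointwise_right_kan_def)
  note [simp] = \<epsilon>[unfolded in_carrier_iff] assms(2,3)
  have univ: "\<exists>!\<phi>'. \<phi>' \<in> sq K H (hunit K ?M) s r \<and> \<phi> = lunit K (hunit K ?M) \<bullet> (\<phi>' \<star> \<epsilon>)"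
    if "H \<in> hor K C ?A" "s \<in> ver K C ?M" "\<phi> \<in> sq K (H \<odot> J) (hunit K ?M) s d" for C H s \<phi>
    using assms(1) that unfolding pointwise_right_kan_def by blast
  fix s \<phi>
  assume asm: "s \<in> ver K ?A ?M \<and> \<phi> \<in> sq K J (hunit K ?M) s d"
  then have [simp]: "s \<in> Ver K" "vdom K s = ?A" "vcod K s = ?M"
    "\<phi> \<in> Cell K" "csrc K \<phi> = J" "ctgt K \<phi> = hunit K ?M" "cleft K \<phi> = s" "cright K \<phi> = d"
    by (auto simp: in_carrier_iff)
  have r: "r \<in> Ver K" "vdom K r = ?A" "vcod K r = ?M" "vdom K d = htgt K J"
    using boundary_simps[of \<epsilon>] boundary_simps[of \<phi>] by simp_all
  note [simp] = r
  have "\<exists>!\<phi>'. \<phi>' \<in> sq K (hunit K ?A) (hunit K ?M) s r \<and>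
      \<phi> \<bullet> lunit K J = lunit K (hunit K ?M) \<bullet> (\<phi>' \<star> \<epsilon>)"
    using asm by (intro univ[where C = ?A]) (auto simp: in_carrier_iff)
  moreover have "\<phi> \<bullet> lunit K J = lunit K (hunit K ?M) \<bullet> (\<phi>' \<star> \<epsilon>) \<longleftrightarrow>
      \<phi> = lunit K (hunit K ?M) \<bullet> (\<phi>' \<star> \<epsilon>) \<bullet> cinv K (lunit K J)"
    if "\<phi>' \<in> sq K (hunit K ?A) (hunit K ?M) s r" for \<phi>'
  proof -
    have [simp]: "\<phi>' \<in> Cell K" "csrc K \<phi>' = hunit K ?A" "ctgt K \<phi>' = hunit K ?M"
      "cleft K \<phi>' = s" "cright K \<phi>' = r"
      using that by (auto simp: in_carrier_iff)
    show ?thesis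
    proof
      assume "\<phi> \<bullet> lunit K J = lunit K (hunit K ?M) \<bullet> (\<phi>' \<star> \<epsilon>)"
      from arg_cong[OF this, of "\<lambda>\<theta>. \<theta> \<bullet> cinv K (lunit K J)"]
      show "\<phi> = lunit K (hunit K ?M) \<bullet> (\<phi>' \<star> \<epsilon>) \<bullet> cinv K (lunit K J)"
        by simp
    next
      assume "\<phi> = lunit K (hunit K ?M) \<bullet> (\<phi>' \<star> \<epsilon>) \<bullet> cinv K (lunit K J)"
      from arg_cong[OF this, of "\<lambda>\<theta>. \<theta> \<bullet> lunit K J"]
      show "\<phi> \<bullet> lunit K J = lunit K (hunit K ?M) \<bullet> (\<phi>' \<star> \<epsilon>)"
        by simp
    qed
  qed
  ultimately show "\<exists>!\<phi>'. \<phi>' \<in> sq K (hunit K ?A) (hunit K ?M) s r \<and>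
      \<phi> = lunit K (hunit K ?M) \<bullet> (\<phi>' \<star> \<epsilon>) \<bullet> cinv K (lunit K J)"
    by (metis (no_types, lifting))
qed

section \<open>Restriction along a vertical morphism and its companion\<close>

text \<open>The cell \<open>u\<close> factors the canonical cell
  \<open>F \<odot> J \<Rightarrow> J\<close>, built from the companion counit, through the cartesian
  cell. The last equation exhibits \<open>R\<close> as a retract of \<open>F \<odot> J\<close>, up
  to the unitor.\<close>

lemma restriction_companion:
  assumes comp: "companion K f F e n" and f: "f \<in> ver K C A" and J: "J \<in> hor K A B"
    and R: "R \<in> hor K C B" and c: "c \<in> sq K R J f (vid K B)" and cart: "cartesian K c"
  obtains u where "u \<in> sq K (F \<odot> J) R (vid K C) (vid K B)"
    and "c \<bullet> u = lunit K J \<bullet> (e \<star> cid K J)"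
    and "u \<bullet> (n \<star> c) = lunit K R"
proof -
  note [simp] = f[unfolded in_carrier_iff] J[unfolded in_carrier_iff] R[unfolded in_carrier_iff]
    c[unfolded in_carrier_iff]
  have [simp]: "A \<in> Obj K" "B \<in> Obj K" "C \<in> Obj K"
    using vdom_Obj[of f] vcod_Obj[of f] htgt_Obj[of J] by simp_all
  have [simp]: "F \<in> Hor K" "hsrc K F = C" "htgt K F = A"
    "e \<in> Cell K" "csrc K e = F" "ctgt K e = hunit K A" "cleft K e = f" "cright K e = vid K A"
    "n \<in> Cell K" "csrc K n = hunit K C" "ctgt K n = F" "cleft K n = vid K C" "cright K n = f"
    "e \<bullet> n = ucell K f"
    using comp by (auto simp: companion_def in_carrier_iff)
  have univ: "\<exists>!\<psi>'. \<psi>' \<in> sq K H R h k \<and> \<psi> = c \<bullet> \<psi>'"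
    if "h \<in> ver K X C" "k \<in> ver K Y B" "H \<in> hor K X Y" "\<psi> \<in> sq K H J (f \<cdot> h) (vid K B \<cdot> k)"
    for X Y H h k \<psi>
    using cart that unfolding cartesian_def by simp
  have "\<exists>!u. u \<in> sq K (F \<odot> J) R (vid K C) (vid K B) \<and> lunit K J \<bullet> (e \<star> cid K J) = c \<bullet> u"
    by (rule univ) (auto simp: in_carrier_iff)
  then obtain u where u: "u \<in> sq K (F \<odot> J) R (vid K C) (vid K B)"
    and cu: "c \<bullet> u = lunit K J \<bullet> (e \<star> cid K J)"
    by metis
  note [simp] = u[unfolded in_carrier_iff]
  \<comment> \<open>Uniqueness of the factor of \<open>c \<bullet> lunit K R\<close> through
    \<open>c\<close> is used to compare two candidates, \<open>lunit K R\<close> and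
    \<open>u \<bullet> (n \<star> c)\<close>. They agree after \<open>c\<close> because
    \<open>e \<bullet> n\<close> is the unit cell of \<open>f\<close>.\<close>
  have "\<exists>!\<psi>. \<psi> \<in> sq K (hunit K C \<odot> R) R (vid K C) (vid K B) \<and> c \<bullet> lunit K R = c \<bullet> \<psi>"
    by (rule univ) (auto simp: in_carrier_iff)
  moreover have "c \<bullet> lunit K R = c \<bullet> (u \<bullet> (n \<star> c))"
  proof -
    have "c \<bullet> (u \<bullet> (n \<star> c)) = (c \<bullet> u) \<bullet> (n \<star> c)"
      by simp
    also have "\<dots> = lunit K J \<bullet> (ucell K f \<star> c)"
      unfolding cu by (simp add: interchange_simp)
    also have "\<dots> = c \<bullet> lunit K R"
      using lunit_natural'[of c] by simp
    finally show ?thesis ..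
  qed
  moreover have "lunit K R \<in> sq K (hunit K C \<odot> R) R (vid K C) (vid K B)"
    "u \<bullet> (n \<star> c) \<in> sq K (hunit K C \<odot> R) R (vid K C) (vid K B)"
    by (auto simp: in_carrier_iff)
  ultimately have "u \<bullet> (n \<star> c) = lunit K R"
    by blast
  with u cu show thesis
    by (rule that)
qed

text \<open>Existence rests on the retraction equation \<open>un\<close>. For uniqueness, a factor
  through \<open>\<epsilon> \<bullet> c\<close> is extended by the counit \<open>e\<close> to a
  factor through \<epsilon> of the extended cell, using \<open>cu\<close>; precomposing with the
  unit \<open>n\<close> recovers it.\<close>

lemma pointwise_right_kan_restriction:
  assumes kan: "pointwise_right_kan K \<epsilon> r d J"
    and J: "J \<in> hor K A B" and d: "d \<in> ver K B M" and r: "r \<in> ver K A M"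
    and comp: "companion K f F e n" and f: "f \<in> ver K C A"
    and R: "R \<in> hor K C B" and c: "c \<in> sq K R J f (vid K B)" and cart: "cartesian K c"
  shows "pointwise_right_kan K (\<epsilon> \<bullet> c) (r \<cdot> f) d R"
proof -
  note [simp] = J[unfolded in_carrier_iff] d[unfolded in_carrier_iff] r[unfolded in_carrier_iff]
    f[unfolded in_carrier_iff] R[unfolded in_carrier_iff] c[unfolded in_carrier_iff]
  have [simp]: "A \<in> Obj K" "B \<in> Obj K" "C \<in> Obj K" "M \<in> Obj K"
    using vdom_Obj[of f] vcod_Obj[of f] htgt_Obj[of J] vcod_Obj[of d] by simp_all
  have [simp]: "F \<in> Hor K" "hsrc K F = C" "htgt K F = A"
    "e \<in> Cell K" "csrc K e = F" "ctgt K e = hunit K A" "cleft K e = f" "cright K e = vid K A"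
    "n \<in> Cell K" "csrc K n = hunit K C" "ctgt K n = F" "cleft K n = vid K C" "cright K n = f"
    and en: "e \<bullet> n = ucell K f"
    using comp by (auto simp: companion_def in_carrier_iff)
  have \<epsilon>: "\<epsilon> \<in> sq K J (hunit K M) r d"
    using kan by (simp add: pointwise_right_kan_def)
  note [simp] = \<epsilon>[unfolded in_carrier_iff]
  have univ: "\<exists>!\<phi>'. \<phi>' \<in> sq K H (hunit K M) s r \<and> \<phi> = lunit K (hunit K M) \<bullet> (\<phi>' \<star> \<epsilon>)"
    if "H \<in> hor K X A" "s \<in> ver K X M" "\<phi> \<in> sq K (H \<odot> J) (hunit K M) s d" for X H s \<phi>
    using kan that unfolding pointwise_right_kan_def by simp
  obtain u where u: "u \<in> sq K (F \<odot> J) R (vid K C) (vid K B)"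
    and cu: "c \<bullet> u = lunit K J \<bullet> (e \<star> cid K J)" and un: "u \<bullet> (n \<star> c) = lunit K R"
    using restriction_companion[OF comp f J R c cart] by metis
  note [simp] = u[unfolded in_carrier_iff]
  let ?I = "hunit K M"
  show ?thesis
    unfolding pointwise_right_kan_def
  proof (intro conjI allI impI)
    show "\<epsilon> \<bullet> c \<in> sq K R (hunit K (vcod K d)) (r \<cdot> f) d"
      by (simp add: in_carrier_iff)
    fix X G s \<phi>
    assume "G \<in> hor K X (hsrc K R) \<and> s \<in> ver K X (vcod K d) \<and>
      \<phi> \<in> sq K (G \<odot> R) (hunit K (vcod K d)) s d"
    then have [simp]: "G \<in> Hor K" "hsrc K G = X" "htgt K G = C"
      "s \<in> Ver K" "vdom K s = X" "vcod K s = M"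
      "\<phi> \<in> Cell K" "csrc K \<phi> = G \<odot> R" "ctgt K \<phi> = ?I" "cleft K \<phi> = s" "cright K \<phi> = d"
      by (auto simp: in_carrier_iff)
    have [simp]: "X \<in> Obj K"
      using hsrc_Obj[of G] by simp
    \<comment> \<open>The pointwise property of \<epsilon> is tested on \<open>G \<odot> F\<close>,
      with \<phi> extended along \<open>u\<close>; the associator supplies the bracketing
      required.\<close>
    have "\<exists>!\<phi>'. \<phi>' \<in> sq K (G \<odot> F) ?I s r \<and>
        \<phi> \<bullet> (cid K G \<star> u) \<bullet> assoc K G F J = lunit K ?I \<bullet> (\<phi>' \<star> \<epsilon>)"
      by (rule univ[where X = X]) (auto simp: in_carrier_iff)
    then obtain \<theta> where \<theta>: "\<theta> \<in> sq K (G \<odot> F) ?I s r"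
      and fac: "\<phi> \<bullet> (cid K G \<star> u) \<bullet> assoc K G F J = lunit K ?I \<bullet> (\<theta> \<star> \<epsilon>)"
      and uniq: "\<And>\<theta>'. \<lbrakk>\<theta>' \<in> sq K (G \<odot> F) ?I s r;
        \<phi> \<bullet> (cid K G \<star> u) \<bullet> assoc K G F J = lunit K ?I \<bullet> (\<theta>' \<star> \<epsilon>)\<rbrakk> \<Longrightarrow> \<theta>' = \<theta>"
      by metis
    note [simp] = \<theta>[unfolded in_carrier_iff]
    let ?\<phi>' = "\<theta> \<bullet> (cid K G \<star> n) \<bullet> cinv K (runit K G)"
    have "\<phi> = lunit K ?I \<bullet> (?\<phi>' \<star> (\<epsilon> \<bullet> c))"
    proof -
      have "lunit K ?I \<bullet> (?\<phi>' \<star> (\<epsilon> \<bullet> c)) =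
        (lunit K ?I \<bullet> (\<theta> \<star> \<epsilon>)) \<bullet> ((cid K G \<star> n) \<star> c) \<bullet> (cinv K (runit K G) \<star> cid K R)"
        by (simp add: interchange_ccomp interchange_simp)
      also have "\<dots> = \<phi> \<bullet> (cid K G \<star> u) \<bullet>
        (assoc K G F J \<bullet> ((cid K G \<star> n) \<star> c)) \<bullet> (cinv K (runit K G) \<star> cid K R)"
        unfolding fac[symmetric] by simp
      also have "\<dots> = \<phi> \<bullet> ((cid K G \<star> u) \<bullet> (cid K G \<star> (n \<star> c))) \<bullet>
        assoc K G (hunit K C) R \<bullet> (cinv K (runit K G) \<star> cid K R)"
        using assoc_natural'[of "cid K G" n c] by simp
      \<comment> \<open>By \<open>un\<close> the composite of \<open>u\<close> with
        \<open>n \<star> c\<close> is a left unitor; the triangle converts it to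
        \<open>runit K G \<star> cid K R\<close>, which cancels the inverse unitor in
        \<open>?\<phi>'\<close>.\<close>
      also have "\<dots> = \<phi> \<bullet> ((cid K G \<star> lunit K R) \<bullet> assoc K G (hunit K C) R) \<bullet>
        (cinv K (runit K G) \<star> cid K R)"
        by (simp add: interchange_simp interchange_ccomp un)
      also have "\<dots> = \<phi>"
        using triangle'[of G R] by (simp add: interchange_simp del: ccomp_assoc_simp)
      finally show ?thesis ..
    qed
    moreover have "?\<phi>' \<in> sq K G ?I s (r \<cdot> f)"
      by (simp add: in_carrier_iff)
    moreover have "\<phi>' = ?\<phi>'"
      if \<phi>': "\<phi>' \<in> sq K G ?I s (r \<cdot> f)" and eq: "\<phi> = lunit K ?I \<bullet> (\<phi>' \<star> (\<epsilon> \<bullet> c))" for \<phi>'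
    proof -
      note [simp] = \<phi>'[unfolded in_carrier_iff]
      \<comment> \<open>\<open>ucell K r \<bullet> e\<close> goes from \<open>F\<close> to a unit
        with left boundary \<open>r \<cdot> f\<close> and right boundary \<open>r\<close>, so it can
        be pasted between \<open>\<phi>'\<close> and \<epsilon>. The outer \<open>runit\<close> is
        what the triangle for two copies of \<open>?I\<close> produces below.\<close>
      let ?\<theta>' = "runit K ?I \<bullet> (\<phi>' \<star> (ucell K r \<bullet> e))"
      have "\<phi> \<bullet> (cid K G \<star> u) \<bullet> assoc K G F J =
        lunit K ?I \<bullet> (\<phi>' \<star> (\<epsilon> \<bullet> (c \<bullet> u))) \<bullet> assoc K G F J"
        unfolding eq by (simp add: interchange_simp interchange_ccomp)
      also have "\<epsilon> \<bullet> (c \<bullet> u) = (\<epsilon> \<bullet> lunit K J) \<bullet> (e \<star> cid K J)"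
        unfolding cu by simp
      also have "\<dots> = lunit K ?I \<bullet> ((ucell K r \<bullet> e) \<star> \<epsilon>)"
        using lunit_natural'[of \<epsilon>, symmetric] by (simp add: interchange_simp)
      also have "lunit K ?I \<bullet> (\<phi>' \<star> \<dots>) \<bullet> assoc K G F J =
        lunit K ?I \<bullet> (cid K ?I \<star> lunit K ?I) \<bullet>
          ((\<phi>' \<star> ((ucell K r \<bullet> e) \<star> \<epsilon>)) \<bullet> assoc K G F J)"
        by (simp add: interchange_simp interchange_ccomp)
      also have "\<dots> = lunit K ?I \<bullet> ((cid K ?I \<star> lunit K ?I) \<bullet> assoc K ?I ?I ?I) \<bullet>
          ((\<phi>' \<star> (ucell K r \<bullet> e)) \<star> \<epsilon>)"
        using assoc_natural'[of \<phi>' "ucell K r \<bullet> e" \<epsilon>] by simp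
      also have "\<dots> = lunit K ?I \<bullet> (?\<theta>' \<star> \<epsilon>)"
        using triangle'[of ?I ?I] by (simp add: interchange_simp del: ccomp_assoc_simp)
      finally have "?\<theta>' = \<theta>"
        by (intro uniq) (simp_all add: in_carrier_iff)
      then have "?\<phi>' = ?\<theta>' \<bullet> (cid K G \<star> n) \<bullet> cinv K (runit K G)"
        by simp
      \<comment> \<open>Interchange brings \<open>e\<close> and \<open>n\<close> together; their
        composite is the unit cell of \<open>f\<close>, and pasting a unit cell on the right changes
        nothing by naturality of \<open>runit\<close>.\<close>
      also have "\<dots> = (runit K ?I \<bullet> (\<phi>' \<star> ucell K (r \<cdot> f))) \<bullet> cinv K (runit K G)"
        by (simp add: interchange_simp interchange_ccomp en ucell_vcomp_simp)
      also have "\<dots> = \<phi>'"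
        using runit_natural'[of \<phi>'] by simp
      finally show ?thesis ..
    qed
    ultimately show "\<exists>!\<phi>'. \<phi>' \<in> sq K G (hunit K (vcod K d)) s (r \<cdot> f) \<and>
        \<phi> = lunit K (hunit K (vcod K d)) \<bullet> (\<phi>' \<star> (\<epsilon> \<bullet> c))"
      by (simp only: d[unfolded in_carrier_iff]) (rule ex1I, blast+)
  qed
qed

section \<open>Restriction along identities\<close>

text \<open>The section \<open>c'\<close> is the factor of \<open>cid K J\<close> through the
  cartesian cell, possible because both vertical boundaries of \<open>c\<close> are
  identities.\<close>

lemma cartesian_vid_right_inverse:
  assumes J: "J \<in> hor K A B" and c: "c \<in> sq K R J (vid K A) (vid K B)" and cart: "cartesian K c"
  obtains c' where "c' \<in> sq K J R (vid K A) (vid K B)" "c \<bullet> c' = cid K J"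
proof -
  have [simp]: "A \<in> Obj K" "B \<in> Obj K"
    using hsrc_Obj[of J] htgt_Obj[of J] J by (auto simp: in_hor_iff)
  have "\<exists>!c'. c' \<in> sq K J R (vid K A) (vid K B) \<and> cid K J = c \<bullet> c'"
    using cart[unfolded cartesian_def, THEN conjunct2, rule_format,
        of "vid K A" A "vid K B" B J "cid K J"] J c
    by (auto simp: in_carrier_iff)
  then show thesis
    by (metis that)
qed

text \<open>A section of \<open>c\<close> makes precomposition with \<open>cid K H \<star> c\<close>
  injective. Hence \<phi> factors through \<epsilon> by a given cell exactly when its restriction
  factors through \<open>\<epsilon> \<bullet> c\<close> by the same cell.\<close>

lemma pointwise_right_kan_of_restriction_vid:
  assumes J: "J \<in> hor K A B" and R: "R \<in> hor K A B" and d: "d \<in> ver K B M"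
    and \<epsilon>: "\<epsilon> \<in> sq K J (hunit K M) r d"
    and c: "c \<in> sq K R J (vid K A) (vid K B)" and cart: "cartesian K c"
    and kan: "pointwise_right_kan K (\<epsilon> \<bullet> c) r d R"
  shows "pointwise_right_kan K \<epsilon> r d J"
proof -
  note [simp] = J[unfolded in_carrier_iff] R[unfolded in_carrier_iff] d[unfolded in_carrier_iff]
    \<epsilon>[unfolded in_carrier_iff] c[unfolded in_carrier_iff]
  have [simp]: "A \<in> Obj K" "B \<in> Obj K" "M \<in> Obj K"
    using hsrc_Obj[of J] htgt_Obj[of J] vcod_Obj[of d] by simp_all
  obtain c' where c': "c' \<in> sq K J R (vid K A) (vid K B)" and cc': "c \<bullet> c' = cid K J"
    using cartesian_vid_right_inverse[OF J c cart] by metis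
  note [simp] = c'[unfolded in_carrier_iff]
  let ?I = "hunit K M"
  have "\<exists>!\<phi>'. \<phi>' \<in> sq K H ?I s r \<and> \<phi> = lunit K ?I \<bullet> (\<phi>' \<star> \<epsilon>)"
    if H: "H \<in> hor K X A" and s: "s \<in> ver K X M" and \<phi>: "\<phi> \<in> sq K (H \<odot> J) ?I s d" for X H s \<phi>
  proof -
    note [simp] = H[unfolded in_carrier_iff] s[unfolded in_carrier_iff] \<phi>[unfolded in_carrier_iff]
    have [simp]: "X \<in> Obj K"
      using hsrc_Obj[of H] by simp
    have "\<phi> \<bullet> (cid K H \<star> c) \<in> sq K (H \<odot> R) ?I s d"
      by (simp add: in_sq_iff)
    then have "\<exists>!\<phi>'. \<phi>' \<in> sq K H ?I s r \<and>
        \<phi> \<bullet> (cid K H \<star> c) = lunit K ?I \<bullet> (\<phi>' \<star> (\<epsilon> \<bullet> c))"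
      using kan H s unfolding pointwise_right_kan_def by simp
    moreover have "\<phi> \<bullet> (cid K H \<star> c) = lunit K ?I \<bullet> (\<phi>' \<star> (\<epsilon> \<bullet> c)) \<longleftrightarrow>
        \<phi> = lunit K ?I \<bullet> (\<phi>' \<star> \<epsilon>)" if \<phi>': "\<phi>' \<in> sq K H ?I s r" for \<phi>'
    proof -
      note [simp] = \<phi>'[unfolded in_carrier_iff]
      have eq: "lunit K ?I \<bullet> (\<phi>' \<star> (\<epsilon> \<bullet> c)) = (lunit K ?I \<bullet> (\<phi>' \<star> \<epsilon>)) \<bullet> (cid K H \<star> c)"
        by (simp add: interchange_simp)
      have "(cid K H \<star> c) \<bullet> (cid K H \<star> c') = cid K (ctgt K (cid K H \<star> c))"
        by (simp add: interchange_simp cc')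
      from ccomp_cancel_right_inverse[OF _ _ _ _ _ _ _ this, of \<phi> "lunit K ?I \<bullet> (\<phi>' \<star> \<epsilon>)"]
      show ?thesis
        unfolding eq by auto
    qed
    ultimately show ?thesis
      by (metis (no_types, lifting))
  qed
  with \<epsilon> show ?thesis
    unfolding pointwise_right_kan_def
    by (simp only: J[unfolded in_carrier_iff] d[unfolded in_carrier_iff]) blast
qed

section \<open>Epic composites of opcartesian and cartesian cells\<close>

text \<open>By \<open>lunit_hcomp\<close> the right-hand side is a right inverse of
  \<open>lunit K (F \<odot> J)\<close>, hence equal to its inverse.\<close>

lemma cinv_lunit_hcomp:
  assumes [simp]: "F \<in> Hor K" "J \<in> Hor K" "htgt K F = hsrc K J"
  shows "cinv K (lunit K (F \<odot> J)) =
    assoc K (hunit K (hsrc K F)) F J \<bullet> (cinv K (lunit K F) \<star> cid K J)"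
proof -
  let ?a = "assoc K (hunit K (hsrc K F)) F J \<bullet> (cinv K (lunit K F) \<star> cid K J)"
  have "lunit K (F \<odot> J) \<bullet> ?a =
    (lunit K (F \<odot> J) \<bullet> assoc K (hunit K (hsrc K F)) F J) \<bullet> (cinv K (lunit K F) \<star> cid K J)"
    by simp
  also have "\<dots> = cid K (F \<odot> J)"
    unfolding lunit_hcomp[OF assms] by (simp add: interchange_simp)
  finally have "cinv K (lunit K (F \<odot> J)) = cinv K (lunit K (F \<odot> J)) \<bullet> (lunit K (F \<odot> J) \<bullet> ?a)"
    by simp
  also have "\<dots> = (cinv K (lunit K (F \<odot> J)) \<bullet> lunit K (F \<odot> J)) \<bullet> ?a"
    by (simp del: lunit_simps(11,12))
  also have "\<dots> = ?a"
    by (simp del: ccomp_assoc_simp)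
  finally show ?thesis .
qed

text \<open>The cell \<open>?t\<close> from \<open>P \<odot> F\<close> to \<open>H\<close> has a
  section \<open>v\<close>, and \<open>?t \<star> cid K J\<close> is built from
  \<open>\<pi> \<star> c\<close> and a conjoint counit. Thus a cell on \<open>H \<odot> J\<close> is
  given by an explicit formula in its composite with \<open>\<pi> \<star> c\<close>.\<close>

lemma opcartesian_chcomp_cartesian_epi:
  assumes \<pi>: "\<pi> \<in> sq K (hunit K T) H p f" and opc: "opcartesian K \<pi>"
    and H: "H \<in> hor K C A" and J: "J \<in> hor K A B"
    and R: "R \<in> hor K T B" and c: "c \<in> sq K R J f (vid K B)" and cart: "cartesian K c"
    and comp: "companion K f F ef nf" and conj: "conjoint K p P ep np"
    and T: "T \<in> Obj K"
    and \<chi>: "\<chi>1 \<in> sq K (H \<odot> J) L s k" "\<chi>2 \<in> sq K (H \<odot> J) L s k"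
    and eq: "\<chi>1 \<bullet> (\<pi> \<star> c) = \<chi>2 \<bullet> (\<pi> \<star> c)"
  shows "\<chi>1 = \<chi>2"
proof -
  note [simp] = \<pi>[unfolded in_carrier_iff] H[unfolded in_carrier_iff] J[unfolded in_carrier_iff]
    R[unfolded in_carrier_iff] c[unfolded in_carrier_iff] T
  have [simp]: "A \<in> Obj K" "B \<in> Obj K" "C \<in> Obj K"
    using hsrc_Obj[of J] htgt_Obj[of J] hsrc_Obj[of H] by simp_all
  have f: "f \<in> ver K T A"
    using boundary_simps[of \<pi>] by (simp add: in_ver_iff)
  have p: "p \<in> ver K T C"
    using boundary_simps[of \<pi>] by (simp add: in_ver_iff)
  note [simp] = f[unfolded in_carrier_iff] p[unfolded in_carrier_iff]
  have [simp]: "F \<in> Hor K" "hsrc K F = T" "htgt K F = A"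
    "ef \<in> Cell K" "csrc K ef = F" "ctgt K ef = hunit K A" "cleft K ef = f" "cright K ef = vid K A"
    "nf \<in> Cell K" "csrc K nf = hunit K T" "ctgt K nf = F" "cleft K nf = vid K T" "cright K nf = f"
    and en: "ef \<bullet> nf = ucell K f"
    using comp by (auto simp: companion_def in_carrier_iff)
  have [simp]: "P \<in> Hor K" "hsrc K P = C" "htgt K P = T"
    "ep \<in> Cell K" "csrc K ep = P" "ctgt K ep = hunit K C" "cleft K ep = vid K C" "cright K ep = p"
    "np \<in> Cell K" "csrc K np = hunit K T" "ctgt K np = P" "cleft K np = p" "cright K np = vid K T"
    and enp: "ep \<bullet> np = ucell K p"
    using conj by (auto simp: conjoint_def in_carrier_iff)
  obtain u where u: "u \<in> sq K (F \<odot> J) R (vid K T) (vid K B)"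
    and cu: "c \<bullet> u = lunit K J \<bullet> (ef \<star> cid K J)"
    using restriction_companion[OF comp f J R c cart] by metis
  note [simp] = u[unfolded in_carrier_iff]
  have univ: "\<exists>!\<chi>'. \<chi>' \<in> sq K H G (vid K C) (vid K A) \<and> \<chi> = \<chi>' \<bullet> \<pi>"
    if "G \<in> hor K C A" "\<chi> \<in> sq K (hunit K T) G p f" for G \<chi>
    using opc[unfolded opcartesian_def, THEN conjunct2, rule_format, of "vid K C" C "vid K A" A G \<chi>]
      that by (simp add: in_ver_iff)
  \<comment> \<open>\<open>?\<tau>\<close> from \<open>F\<close> to \<open>H\<close> is the
    transpose of \<pi> across the companion of \<open>f\<close>; \<open>?t\<close> transposes it
    further across the conjoint of \<open>p\<close>, so that both vertical boundaries become
    identities.\<close>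
  let ?\<tau> = "runit K H \<bullet> (\<pi> \<star> ef) \<bullet> cinv K (lunit K F)"
  let ?t = "lunit K H \<bullet> (ep \<star> ?\<tau>)"
  let ?\<kappa> = "(\<pi> \<star> c) \<bullet> cinv K (lunit K R)"
  have \<kappa>u: "?\<kappa> \<bullet> u = ?\<tau> \<star> cid K J"
  proof -
    have "?\<kappa> \<bullet> u = (\<pi> \<star> c) \<bullet> (cinv K (lunit K R) \<bullet> u)"
      by simp
    \<comment> \<open>The left boundary of \<open>u\<close> is an identity, so the unit cell
      produced by naturality is an identity cell and \<open>u\<close> moves next to
      \<open>c\<close>.\<close>
    also have "\<dots> = (\<pi> \<star> (c \<bullet> u)) \<bullet> cinv K (lunit K (F \<odot> J))"
      using cinv_lunit_natural[of u] by (simp add: interchange_ccomp)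
    also have "\<dots> = (cid K H \<star> lunit K J) \<bullet> (\<pi> \<star> (ef \<star> cid K J)) \<bullet>
      cinv K (lunit K (F \<odot> J))"
      unfolding cu by (simp add: interchange_ccomp)
    \<comment> \<open>Rewriting the inverse unitor of \<open>F \<odot> J\<close> places it on
      \<open>F\<close> alone; associator naturality and the triangle then assemble
      \<open>?\<tau>\<close>.\<close>
    also have "\<dots> = (cid K H \<star> lunit K J) \<bullet> ((\<pi> \<star> (ef \<star> cid K J)) \<bullet>
      assoc K (hunit K T) F J) \<bullet> (cinv K (lunit K F) \<star> cid K J)"
      by (simp add: cinv_lunit_hcomp)
    also have "\<dots> = ((cid K H \<star> lunit K J) \<bullet> assoc K H (hunit K A) J) \<bullet>
      ((\<pi> \<star> ef) \<star> cid K J) \<bullet> (cinv K (lunit K F) \<star> cid K J)"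
      using assoc_natural'[of \<pi> ef "cid K J", symmetric] by simp
    also have "\<dots> = ?\<tau> \<star> cid K J"
      using triangle'[of H J] by (simp add: interchange_simp del: ccomp_assoc_simp)
    finally show ?thesis .
  qed
  have t: "lunit K (H \<odot> J) \<bullet> (ep \<star> (?\<kappa> \<bullet> u)) \<bullet> assoc K P F J = ?t \<star> cid K J"
  proof -
    have "lunit K (H \<odot> J) \<bullet> (ep \<star> (?\<kappa> \<bullet> u)) \<bullet> assoc K P F J =
      (lunit K (H \<odot> J) \<bullet> assoc K (hunit K C) H J) \<bullet> ((ep \<star> ?\<tau>) \<star> cid K J)"
      unfolding \<kappa>u using assoc_natural'[of ep ?\<tau> "cid K J"] by simp
    also have "\<dots> = (lunit K H \<star> cid K J) \<bullet> ((ep \<star> ?\<tau>) \<star> cid K J)"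
      using lunit_hcomp[of H J] by (simp del: ccomp_assoc_simp)
    also have "\<dots> = ?t \<star> cid K J"
      by (simp add: interchange_simp)
    finally show ?thesis .
  qed
  \<comment> \<open>Splitting the unit with \<open>runit\<close> rather than \<open>lunit\<close> avoids the coherence \<open>lunit 1 = runit 1\<close>.\<close>
  obtain v where v: "v \<in> sq K H (P \<odot> F) (vid K C) (vid K A)"
    and v\<pi>: "(np \<star> nf) \<bullet> cinv K (runit K (hunit K T)) = v \<bullet> \<pi>"
    using univ[of "P \<odot> F" "(np \<star> nf) \<bullet> cinv K (runit K (hunit K T))"] by (auto simp: in_carrier_iff)
  note [simp] = v[unfolded in_carrier_iff]
  \<comment> \<open>The units \<open>np\<close> and \<open>nf\<close> in
    \<open>v \<bullet> \<pi>\<close> meet the counits in \<open>?t\<close> and leave unit cells.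
    Since \<pi> is opcartesian, this makes \<open>v\<close> a section of \<open>?t\<close>.\<close>
  have "(?t \<bullet> v) \<bullet> \<pi> = \<pi>"
  proof -
    have "(?t \<bullet> v) \<bullet> \<pi> = ?t \<bullet> (v \<bullet> \<pi>)"
      by simp
    also have "\<dots> = (lunit K H \<bullet> (ucell K p \<star> (?\<tau> \<bullet> nf))) \<bullet> cinv K (runit K (hunit K T))"
      unfolding v\<pi>[symmetric] by (simp add: interchange_simp interchange_ccomp enp)
    also have "\<dots> = (?\<tau> \<bullet> nf) \<bullet> lunit K (hunit K T) \<bullet> cinv K (runit K (hunit K T))"
      using lunit_natural'[of "?\<tau> \<bullet> nf"] by simp
    also have "\<dots> = runit K H \<bullet> (\<pi> \<star> ef) \<bullet> (cinv K (lunit K F) \<bullet> nf) \<bullet>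
      lunit K (hunit K T) \<bullet> cinv K (runit K (hunit K T))"
      by simp
    also have "\<dots> = (runit K H \<bullet> (\<pi> \<star> ucell K f)) \<bullet>
      (cinv K (lunit K (hunit K T)) \<bullet> lunit K (hunit K T)) \<bullet> cinv K (runit K (hunit K T))"
      using cinv_lunit_natural[of nf]
      by (simp add: interchange_ccomp en del: lunit_simps(11,12))
    also have "\<dots> = (\<pi> \<bullet> runit K (hunit K T)) \<bullet> cinv K (runit K (hunit K T))"
      using runit_natural'[of \<pi>] by (simp del: ccomp_assoc_simp)
    also have "\<dots> = \<pi>"
      by simp
    finally show ?thesis .
  qed
  moreover have "?t \<bullet> v \<in> sq K H H (vid K C) (vid K A)" "cid K H \<in> sq K H H (vid K C) (vid K A)"
    by (simp_all add: in_sq_iff)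
  moreover have "\<pi> = cid K H \<bullet> \<pi>"
    by simp
  ultimately have tv: "?t \<bullet> v = cid K H"
    using univ[OF H \<pi>] by (metis (no_types, lifting))
  \<comment> \<open>Obtained from \<open>\<chi> = \<chi> \<bullet> (?t \<star> cid K J) \<bullet> (v
    \<star> cid K J)\<close> by substituting \<open>t\<close> and moving \<chi> past the unitor.
    With the boundary fixed, \<chi> enters the right-hand side only through
    \<open>\<chi> \<bullet> (\<pi> \<star> c)\<close>.\<close>
  have retr: "\<chi> = lunit K L \<bullet> ((ucell K s \<bullet> ep) \<star> ((\<chi> \<bullet> (\<pi> \<star> c)) \<bullet> cinv K (lunit K R) \<bullet> u)) \<bullet>
      assoc K P F J \<bullet> (v \<star> cid K J)"
    if \<chi>: "\<chi> \<in> sq K (H \<odot> J) L s k" for \<chi>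
  proof -
    note [simp] = \<chi>[unfolded in_carrier_iff]
    have [simp]: "s \<in> Ver K" "vdom K s = C" "vcod K s = hsrc K L" "L \<in> Hor K"
      using boundary_simps[of \<chi>] ctgt_Hor[of \<chi>] by simp_all
    have "\<chi> = \<chi> \<bullet> (?t \<star> cid K J) \<bullet> (v \<star> cid K J)"
      by (simp add: interchange_simp tv[simplified])
    also have "\<dots> = (\<chi> \<bullet> lunit K (H \<odot> J)) \<bullet> (ep \<star> (?\<kappa> \<bullet> u)) \<bullet> assoc K P F J \<bullet> (v \<star> cid K J)"
      unfolding t[symmetric] by simp
    also have "\<dots> = lunit K L \<bullet> ((ucell K s \<bullet> ep) \<star> (\<chi> \<bullet> ?\<kappa> \<bullet> u)) \<bullet> assoc K P F J \<bullet>
      (v \<star> cid K J)"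
      using lunit_natural'[of \<chi>, symmetric] by (simp add: interchange_ccomp)
    finally show ?thesis
      by simp
  qed
  show ?thesis
    using retr[OF \<chi>(1)] retr[OF \<chi>(2)] unfolding eq by simp
qed

end

section \<open>Comparison of the conditions (a), (b) and (c)\<close>

theorem theorem5p11:
  fixes K :: "('o, 'v, 'h, 'c) equipment_data" (structure)
    and A B M :: 'o and J :: 'h and d r :: 'v and \<epsilon> :: 'c
    and restr :: "'v \<Rightarrow> 'h" and cart :: "'v \<Rightarrow> 'c"
  assumes "equipment K"
    and "J \<in> hor K A B"
    and "d \<in> ver K B M"
    and "r \<in> ver K A M"
    and "\<epsilon> \<in> sq K J (hunit K M) r d"
    and cart: "\<And>C f. f \<in> ver K C A \<Longrightarrow>
      restr f \<in> hor K C B \<and> cart f \<in> sq K (restr f) J f (vid K B) \<and> cartesian K (cart f)"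
  shows
    "(pointwise_right_kan K \<epsilon> r d J \<longleftrightarrow>
      (\<forall>C. \<forall>f \<in> ver K C A. pointwise_right_kan K (\<epsilon> \<bullet> cart f) (r \<cdot> f) d (restr f))) \<and>
     ((\<forall>C. \<forall>f \<in> ver K C A. pointwise_right_kan K (\<epsilon> \<bullet> cart f) (r \<cdot> f) d (restr f)) \<longrightarrow>
      (\<forall>C. \<forall>f \<in> ver K C A. right_kan K (\<epsilon> \<bullet> cart f) (r \<cdot> f) d (restr f))) \<and>
     (has_opcartesian_tabulations K \<longrightarrow>
      (\<forall>C. \<forall>f \<in> ver K C A. right_kan K (\<epsilon> \<bullet> cart f) (r \<cdot> f) d (restr f)) \<longrightarrow>
      pointwise_right_kan K \<epsilon> r d J)"
proof -
  interpret equipment K by fact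
  note J = assms(2) and d = assms(3) and r = assms(4) and \<epsilon> = assms(5)
  note [simp] = J[unfolded in_carrier_iff] d[unfolded in_carrier_iff] r[unfolded in_carrier_iff]
    \<epsilon>[unfolded in_carrier_iff]
  have [simp]: "A \<in> Obj K" "B \<in> Obj K" "M \<in> Obj K"
    using hsrc_Obj[of J] htgt_Obj[of J] vcod_Obj[of d] by simp_all
  note restr = cart[THEN conjunct1] and cart_sq = cart[THEN conjunct2, THEN conjunct1]
    and cart_univ = cart[THEN conjunct2, THEN conjunct2]
  have comp: "companion K f (comp_hor K f) (comp_counit K f) (comp_unit K f)"
    and conj: "conjoint K f (conj_hor K f) (conj_counit K f) (conj_unit K f)"
    if "f \<in> ver K C D" for f C D
    using that companion_comp conjoint_conj by (auto simp: in_ver_iff)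
  have ab: "pointwise_right_kan K (\<epsilon> \<bullet> cart f) (r \<cdot> f) d (restr f)"
    if "pointwise_right_kan K \<epsilon> r d J" "f \<in> ver K C A" for C f
    using pointwise_right_kan_restriction[OF that(1) J d r comp[OF that(2)] that(2)
        restr[OF that(2)] cart_sq[OF that(2)] cart_univ[OF that(2)]] .
  \<comment> \<open>Condition (b) is used only at \<open>vid K A\<close>, where
    \<open>r \<cdot> vid K A\<close> is \<open>r\<close>.\<close>
  have ba: "pointwise_right_kan K \<epsilon> r d J"
    if "\<forall>C. \<forall>f \<in> ver K C A. pointwise_right_kan K (\<epsilon> \<bullet> cart f) (r \<cdot> f) d (restr f)"
  proof (rule pointwise_right_kan_of_restriction_vid[OF J _ d \<epsilon>])
    have id: "vid K A \<in> ver K A A"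
      by (rule vid_ver) simp
    show "restr (vid K A) \<in> hor K A B" "cart (vid K A) \<in> sq K (restr (vid K A)) J (vid K A) (vid K B)"
      "cartesian K (cart (vid K A))"
      using cart[OF id] by blast+
    show "pointwise_right_kan K (\<epsilon> \<bullet> cart (vid K A)) r d (restr (vid K A))"
      using that id by fastforce
  qed
  have bc: "right_kan K (\<epsilon> \<bullet> cart f) (r \<cdot> f) d (restr f)"
    if "pointwise_right_kan K (\<epsilon> \<bullet> cart f) (r \<cdot> f) d (restr f)" "f \<in> ver K C A" for C f
    using that(1) restr[OF that(2)] by (intro pointwise_imp_right_kan) (auto simp: in_hor_iff)
  have ca: "pointwise_right_kan K \<epsilon> r d J"
    if tab: "has_opcartesian_tabulations K"
      and kan: "\<forall>C. \<forall>f \<in> ver K C A. right_kan K (\<epsilon> \<bullet> cart f) (r \<cdot> f) d (restr f)"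
  proof -
    let ?I = "hunit K M"
    have "\<exists>!\<phi>'. \<phi>' \<in> sq K H ?I s r \<and> \<phi> = lunit K ?I \<bullet> (\<phi>' \<star> \<epsilon>)"
      if H: "H \<in> hor K C A" and s: "s \<in> ver K C M" and \<phi>: "\<phi> \<in> sq K (H \<odot> J) ?I s d" for C H s \<phi>
    proof -
      note [simp] = H[unfolded in_carrier_iff] s[unfolded in_carrier_iff] \<phi>[unfolded in_carrier_iff]
      have [simp]: "C \<in> Obj K"
        using hsrc_Obj[of H] by simp
      \<comment> \<open>The morphism tabulated is the \<open>H\<close> on which the pointwise
        property is tested; its leg \<open>f\<close> to \<open>A\<close> is the morphism at which
        (c) is applied.\<close>
      obtain T \<pi> where tabH: "tabulation K H T \<pi>" and opc: "opcartesian K \<pi>"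
        using tab H unfolding has_opcartesian_tabulations_def in_hor_iff by blast
      have T: "T \<in> Obj K" and "\<pi> \<in> sq K (hunit K T) H (cleft K \<pi>) (cright K \<pi>)"
        using tabH by (simp_all add: tabulation_def)
      then obtain p f where \<pi>: "\<pi> \<in> sq K (hunit K T) H p f"
        by blast
      note [simp] = T \<pi>[unfolded in_carrier_iff]
      have p: "p \<in> ver K T C" and f: "f \<in> ver K T A"
        using boundary_simps[of \<pi>] by (simp_all add: in_ver_iff)
      note R = restr[OF f] and c = cart_sq[OF f]
      note [simp] = p[unfolded in_carrier_iff] f[unfolded in_carrier_iff] R[unfolded in_carrier_iff]
        c[unfolded in_carrier_iff]
      note epi = opcartesian_chcomp_cartesian_epi[OF \<pi> opc H J R c cart_univ[OF f] comp[OF f]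
          conj[OF p] T]
      let ?R = "restr f" and ?c = "cart f"
      have ukan: "\<exists>!\<psi>. \<psi> \<in> sq K (hunit K T) ?I s' (r \<cdot> f) \<and>
          \<chi> = lunit K ?I \<bullet> (\<psi> \<star> (\<epsilon> \<bullet> ?c)) \<bullet> cinv K (lunit K ?R)"
        if "s' \<in> ver K T M" "\<chi> \<in> sq K ?R ?I s' d" for s' \<chi>
        using kan[rule_format, OF f] that unfolding right_kan_def by simp
      have uop: "\<exists>!\<chi>'. \<chi>' \<in> sq K H ?I s r \<and> \<chi> = \<chi>' \<bullet> \<pi>"
        if "\<chi> \<in> sq K (hunit K T) ?I (s \<cdot> p) (r \<cdot> f)" for \<chi>
        using opc[unfolded opcartesian_def, THEN conjunct2, rule_format, of s M r M ?I \<chi>]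
          that by (simp add: in_ver_iff in_hor_iff)
      let ?\<kappa> = "(\<pi> \<star> ?c) \<bullet> cinv K (lunit K ?R)"
      \<comment> \<open>Factoring \<phi> through \<epsilon> is equivalent to factoring its
        restriction \<open>\<phi> \<bullet> ?\<kappa>\<close> through
        \<open>\<epsilon> \<bullet> ?c\<close>. In the converse direction the unitor of
        \<open>?R\<close> is cancelled and \<open>epi\<close> removes
        \<open>\<pi> \<star> ?c\<close>.\<close>
      have fac: "\<phi> = lunit K ?I \<bullet> (\<phi>' \<star> \<epsilon>) \<longleftrightarrow>
          \<phi> \<bullet> ?\<kappa> = lunit K ?I \<bullet> ((\<phi>' \<bullet> \<pi>) \<star> (\<epsilon> \<bullet> ?c)) \<bullet> cinv K (lunit K ?R)"
        if \<phi>': "\<phi>' \<in> sq K H ?I s r" for \<phi>'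
      proof -
        note [simp] = \<phi>'[unfolded in_carrier_iff]
        have eq: "lunit K ?I \<bullet> ((\<phi>' \<bullet> \<pi>) \<star> (\<epsilon> \<bullet> ?c)) \<bullet> cinv K (lunit K ?R) =
          (lunit K ?I \<bullet> (\<phi>' \<star> \<epsilon>)) \<bullet> ?\<kappa>"
          by (simp add: interchange_ccomp)
        show ?thesis
        proof
          assume "\<phi> \<bullet> ?\<kappa> = lunit K ?I \<bullet> ((\<phi>' \<bullet> \<pi>) \<star> (\<epsilon> \<bullet> ?c)) \<bullet> cinv K (lunit K ?R)"
          then have "(\<phi> \<bullet> ?\<kappa>) \<bullet> lunit K ?R = ((lunit K ?I \<bullet> (\<phi>' \<star> \<epsilon>)) \<bullet> ?\<kappa>) \<bullet> lunit K ?R"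
            unfolding eq by simp
          then have "\<phi> \<bullet> (\<pi> \<star> ?c) = (lunit K ?I \<bullet> (\<phi>' \<star> \<epsilon>)) \<bullet> (\<pi> \<star> ?c)"
            by simp
          then show "\<phi> = lunit K ?I \<bullet> (\<phi>' \<star> \<epsilon>)"
            by (intro epi[OF \<phi>]) (simp_all add: in_sq_iff)
        qed (simp add: eq del: ccomp_assoc_simp)
      qed
      have "\<exists>!\<psi>. \<psi> \<in> sq K (hunit K T) ?I (s \<cdot> p) (r \<cdot> f) \<and>
          \<phi> \<bullet> ?\<kappa> = lunit K ?I \<bullet> (\<psi> \<star> (\<epsilon> \<bullet> ?c)) \<bullet> cinv K (lunit K ?R)"
        by (rule ukan) (simp_all add: in_carrier_iff)
      then obtain \<psi> where \<psi>: "\<psi> \<in> sq K (hunit K T) ?I (s \<cdot> p) (r \<cdot> f)"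
        and \<psi>_iff: "\<And>\<psi>'. \<psi>' \<in> sq K (hunit K T) ?I (s \<cdot> p) (r \<cdot> f) \<Longrightarrow>
          \<phi> \<bullet> ?\<kappa> = lunit K ?I \<bullet> (\<psi>' \<star> (\<epsilon> \<bullet> ?c)) \<bullet> cinv K (lunit K ?R) \<longleftrightarrow> \<psi> = \<psi>'"
        by blast
      \<comment> \<open>The factors of \<phi> are thus exactly the extensions of \<psi> along \<pi>,
        and by opcartesianness there is precisely one.\<close>
      have "\<phi> = lunit K ?I \<bullet> (\<phi>' \<star> \<epsilon>) \<longleftrightarrow> \<psi> = \<phi>' \<bullet> \<pi>" if "\<phi>' \<in> sq K H ?I s r" for \<phi>'
        unfolding fac[OF that] by (rule \<psi>_iff[OF ccomp_sq[OF \<pi> that]])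
      with uop[OF \<psi>] show ?thesis
        by (metis (no_types, lifting))
    qed
    with \<epsilon> show ?thesis
      unfolding pointwise_right_kan_def
      by (simp only: J[unfolded in_carrier_iff] d[unfolded in_carrier_iff]) blast
  qed
  show ?thesis
    using ab ba bc ca by blast
qed

end
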